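(* Let $K$ be a field (of arbitrary characteristic), let $A_n=K\langle x_1,\dots,x_n\rangle$ ($n\ge 2$) be the free associative algebra over $K$, and let $f,g\in A_n$ be algebraically independent over $K$. Suppose that the leading monomials $v(f)$ and $v(g)$ are algebraically dependent over $K$, and that neither $\deg(f)$ divides $\deg(g)$ nor $\deg(g)$ divides $\deg(f)$. Then for every $P(x,y)\in K\langle x,y\rangle\setminus K$, $$\deg(P(f,g))\ \ge\ w_{\deg(f),\deg(g)}(P(x,y))\,\frac{\deg([f,g])}{\deg(f)+\deg(g)}.$$
   Context: $K\langle x,y\rangle$ is the free associative algebra on two noncommuting variables; $P(f,g)$ is the result of substituting $x\mapsto f$, $y\mapsto g$. $[f,g]=fg-gf$. $\deg$ is the total degree on $A_n$ (each $x_i$ has degree $1$). Two elements are algebraically independent over $K$ if the subalgebra they generate is free of rank two (freely generated by them); otherwise they are algebraically dependent. Leading monomials: let $F$ be the free group on $x_1,\dots,x_n$, with $\deg:F\to\mathbb Z$ the homomorphism sending each $x_i$ to $1$. Fix a total order on $F$ which is a group order ($a>b$ implies $ca>cb$ and $ac>bc$ for all $c$) and extends the degree ($\deg a>\deg b$ implies $a>b$); such an order exists. For $0\ne f\in A_n$, $v(f)$ is the greatest monomial, with respect to this order, occurring in $f$ with nonzero coefficient. Weighted degree: for a monomial $M$ in $x,y$, $w_{a,b}(M)=a\deg_x(M)+b\deg_y(M)$, where $\deg_x(M),\deg_y(M)$ are the numbers of occurrences of $x,y$ in $M$; for a nonzero polynomial $P$, $w_{a,b}(P)$ is the maximum of $w_{a,b}(M)$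 over the monomials $M$ occurring in $P$. *)

theory Defs
  imports Complex_Main "HOL-Library.Poly_Mapping"
begin

text \<open>
  The free monoid on a set of letters is the type of lists under concatenation.  It is written
  additively because the convolution product of \<^theory>\<open>HOL-Library.Poly_Mapping\<close> takes its
  exponents from an additive (not necessarily commutative) monoid.
\<close>

instantiation list :: (type) monoid_add
begin
definition zero_list :: "'a list" where "0 = []"
definition plus_list :: "'a list \<Rightarrow> 'a list \<Rightarrow> 'a list" where "xs + ys = xs @ ys"
instance by standard (simp_all add: zero_list_def plus_list_def)
end

text \<open>The monoid algebra of the free monoid, i.e. the free associative algebra on the letters
  \<open>'a\<close> over \<open>'k\<close>; the ring structure is the library's.\<close>

type_synonym ('a, 'k) free_algebra = "'a list \<Rightarrow>\<^sub>0 'k"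

definition scalar :: "'k::field \<Rightarrow> ('a, 'k) free_algebra" where
  "scalar c = Poly_Mapping.single [] c"

definition monomial :: "'a list \<Rightarrow> ('a, 'k::field) free_algebra" where
  "monomial m = Poly_Mapping.single m 1"

definition commutator :: "('a, 'k::field) free_algebra \<Rightarrow> ('a, 'k) free_algebra \<Rightarrow> ('a, 'k) free_algebra" where
  "commutator f g = f * g - g * f"

text \<open>Total degree; the zero element, which has no degree, is given the dummy value 0.\<close>

definition deg :: "('a, 'k::field) free_algebra \<Rightarrow> nat" where
  "deg f = (if f = 0 then 0 else Max (length ` Poly_Mapping.keys f))"

datatype xy = X | Y

definition subst_xy :: "('a, 'k::field) free_algebra \<Rightarrow> ('a, 'k) free_algebra \<Rightarrow>
    (xy, 'k) free_algebra \<Rightarrow> ('a, 'k) free_algebra" where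
  "subst_xy f g P =
     (\<Sum>m\<in>Poly_Mapping.keys P. scalar (Poly_Mapping.lookup P m) * prod_list (map (case_xy f g) m))"

definition weight :: "nat \<Rightarrow> nat \<Rightarrow> xy list \<Rightarrow> nat" where
  "weight a b m = a * count_list m X + b * count_list m Y"

text \<open>As for the degree, the value 0 at the zero polynomial is a dummy.\<close>

definition weighted_deg :: "nat \<Rightarrow> nat \<Rightarrow> (xy, 'k::field) free_algebra \<Rightarrow> nat" where
  "weighted_deg a b P = (if P = 0 then 0 else Max (weight a b ` Poly_Mapping.keys P))"

text \<open>The subalgebra (with unit) generated by a set.\<close>

inductive_set subalgebra_gen :: "('a, 'k::field) free_algebra set \<Rightarrow> ('a, 'k) free_algebra set"
  for S where
  scalar: "scalar c \<in> subalgebra_gen S"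
| gen: "s \<in> S \<Longrightarrow> s \<in> subalgebra_gen S"
| add: "u \<in> subalgebra_gen S \<Longrightarrow> v \<in> subalgebra_gen S \<Longrightarrow> u + v \<in> subalgebra_gen S"
| mult: "u \<in> subalgebra_gen S \<Longrightarrow> v \<in> subalgebra_gen S \<Longrightarrow> u * v \<in> subalgebra_gen S"

text \<open>The subalgebra generated by \<open>f, g\<close> is freely generated by them: the substitution
  homomorphism from the free algebra on \<open>x, y\<close> is a bijection onto it.\<close>

definition alg_independent :: "('a, 'k::field) free_algebra \<Rightarrow> ('a, 'k) free_algebra \<Rightarrow> bool" where
  "alg_independent f g \<longleftrightarrow> bij_betw (subst_xy f g) UNIV (subalgebra_gen {f, g})"

abbreviation alg_dependent :: "('a, 'k::field) free_algebra \<Rightarrow> ('a, 'k) free_algebra \<Rightarrow> bool" where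
  "alg_dependent f g \<equiv> \<not> alg_independent f g"

text \<open>
  The free group on \<open>'a\<close>, also written additively: words in letters \<open>(i, e)\<close>, where \<open>e = False\<close>
  stands for the generator \<open>i\<close> and \<open>e = True\<close> for its inverse, modulo deletion and insertion of
  adjacent mutually inverse letters.
\<close>

inductive cancels :: "('a \<times> bool) list \<Rightarrow> ('a \<times> bool) list \<Rightarrow> bool" where
  "cancels (u @ [(i, e), (i, \<not> e)] @ w) (u @ w)"

abbreviation free_eq :: "('a \<times> bool) list \<Rightarrow> ('a \<times> bool) list \<Rightarrow> bool" where
  "free_eq \<equiv> equivclp cancels"

definition inv_word :: "('a \<times> bool) list \<Rightarrow> ('a \<times> bool) list" where
  "inv_word w = rev (map (\<lambda>(i, e). (i, \<not> e)) w)"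

definition word_deg :: "('a \<times> bool) list \<Rightarrow> int" where
  "word_deg w = (\<Sum>(i, e)\<leftarrow>w. if e then - 1 else 1)"

lemma free_eq_append:
  assumes "free_eq u u'" "free_eq v v'"
  shows "free_eq (u @ v) (u' @ v')"
proof -
  have l: "cancels (p @ a) (p @ b)" if "cancels a b" for p a b :: "('a \<times> bool) list"
    using that
  proof cases
    case (1 u i e w)
    then show ?thesis using cancels.intros[of "p @ u" i e w] by simp
  qed
  have r: "cancels (a @ p) (b @ p)" if "cancels a b" for p a b :: "('a \<times> bool) list"
    using that
  proof cases
    case (1 u i e w)
    then show ?thesis using cancels.intros[of u i e "w @ p"] by simp
  qed
  have R: "free_eq (u @ v) (u' @ v)"
    using assms(1)
    by (induction rule: equivclp_induct)
       (auto intro: equivclp_into_equivclp r elim!: disjE)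
  have L: "free_eq (u' @ v) (u' @ v')"
    using assms(2)
    by (induction rule: equivclp_induct)
       (auto intro: equivclp_into_equivclp l elim!: disjE)
  from R L show ?thesis by (rule equivclp_trans)
qed

lemma free_eq_inv_word:
  assumes "free_eq u v"
  shows "free_eq (inv_word u) (inv_word v)"
proof -
  have c: "cancels (inv_word a) (inv_word b)" if "cancels a b" for a b :: "('a \<times> bool) list"
    using that
  proof cases
    case (1 u i e w)
    then show ?thesis
      using cancels.intros[of "inv_word w" i e "inv_word u"] by (simp add: inv_word_def)
  qed
  show ?thesis
    using assms
    by (induction rule: equivclp_induct)
       (auto intro: equivclp_into_equivclp c elim!: disjE)
qed

lemma free_eq_word_deg:
  assumes "free_eq u v"
  shows "word_deg u = word_deg v"
  using assms
  by (induction rule: equivclp_induct) (auto simp: word_deg_def elim!: cancels.cases)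

lemma free_eq_inv_word_left: "free_eq (inv_word w @ w) []"
proof (induction w)
  case Nil
  then show ?case by (simp add: inv_word_def)
next
  case (Cons a w)
  obtain i e where a: "a = (i, e)" by (cases a)
  have "cancels (inv_word (a # w) @ a # w) (inv_word w @ w)"
    using cancels.intros[of "inv_word w" i "\<not> e" w] by (simp add: a inv_word_def)
  then show ?case using Cons.IH by (blast intro: equivclp_trans)
qed

quotient_type 'a free_group = "('a \<times> bool) list" / "equivclp cancels"
  by simp

instantiation free_group :: (type) group_add
begin
lift_definition zero_free_group :: "'a free_group" is "[]" .
lift_definition plus_free_group :: "'a free_group \<Rightarrow> 'a free_group \<Rightarrow> 'a free_group" is "(@)"
  by (rule free_eq_append)
lift_definition uminus_free_group :: "'a free_group \<Rightarrow> 'a free_group" is inv_word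
  by (rule free_eq_inv_word)
definition minus_free_group :: "'a free_group \<Rightarrow> 'a free_group \<Rightarrow> 'a free_group" where
  "a - b = a + - (b :: 'a free_group)"
instance
  by standard (unfold minus_free_group_def, (transfer, simp add: free_eq_inv_word_left)+)
end

lift_definition group_deg :: "'a free_group \<Rightarrow> int" is word_deg
  by (rule free_eq_word_deg)

text \<open>The canonical embedding of the free monoid into the free group.\<close>

lift_definition of_monoid :: "'a list \<Rightarrow> 'a free_group" is "map (\<lambda>i. (i, False))" .

text \<open>Strict total group orders on the free group that extend the degree; \<open>lt a b\<close> means
  \<open>a < b\<close>.\<close>

definition degree_group_order :: "('a free_group \<Rightarrow> 'a free_group \<Rightarrow> bool) \<Rightarrow> bool" where
  "degree_group_order lt \<longleftrightarrow>
     irreflp lt \<and> transp lt \<and> totalp lt \<and>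
     (\<forall>a b c. lt b a \<longrightarrow> lt (c + b) (c + a) \<and> lt (b + c) (a + c)) \<and>
     (\<forall>a b. group_deg b < group_deg a \<longrightarrow> lt b a)"

text \<open>The leading monomial as an exponent word (only meaningful for a nonzero element).\<close>

definition leading_word :: "('a free_group \<Rightarrow> 'a free_group \<Rightarrow> bool) \<Rightarrow>
    ('a, 'k::field) free_algebra \<Rightarrow> 'a list" where
  "leading_word lt f = (THE m. m \<in> Poly_Mapping.keys f \<and>
     (\<forall>m'\<in>Poly_Mapping.keys f. m' \<noteq> m \<longrightarrow> lt (of_monoid m') (of_monoid m)))"

definition leading_monomial :: "('a free_group \<Rightarrow> 'a free_group \<Rightarrow> bool) \<Rightarrow>
    ('a, 'k::field) free_algebra \<Rightarrow> ('a, 'k) free_algebra" where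
  "leading_monomial lt f = monomial (leading_word lt f)"

end

theory Submission
  imports Defs
begin

text \<open>
  Let \<open>lw\<close> denote leading words for the degree-lexicographic order.  If
  \<open>lw f\<close> and \<open>lw g\<close> do not commute they generate a free monoid and no cancellation occurs in
  \<open>P(f, g)\<close>.  Otherwise both are powers of a primitive word \<open>t\<close>, while \<open>\<sigma> = lw [f, g]\<close> is not.
  Commuting \<open>P(f, g)\<close> with a high power \<open>h\<close> of \<open>f\<close> gives a sum of terms \<open>R\<^sub>l(f, g) [h, g] b\<^sub>l\<close>, one for
  each occurrence of \<open>y\<close> in \<open>P\<close>, rearranged so that the \<open>b\<^sub>l\<close> have distinct leading words; up to
  reversing all words, \<open>lw [h, g]\<close> is a high power of \<open>t\<close> times \<open>\<sigma>\<close>.  Every leading word \<open>w\<close> of an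
  element of \<open>K\<langle>f, g\<rangle>\<close> compares in the same way as \<open>\<sigma>\<close> does with \<open>t\<close> (\<open>wt \<le> tw\<close> lexicographically), and
  this keeps the leading words of the terms distinct.  So the degree of \<open>P(f, g)\<close> is bounded below
  by that of any single term, to which induction applies.  Since the degrees of \<open>f\<close> and \<open>g\<close> do not
  divide each other, one can choose the term so that the weights add up.
\<close>

section \<open>Powers of words\<close>

abbreviation word_pow :: "nat \<Rightarrow> 'a list \<Rightarrow> 'a list" where
  "word_pow n t \<equiv> concat (replicate n t)"

lemma length_word_pow [simp]: "length (word_pow n t) = n * length t"
  by (induction n) auto

lemma word_pow_add: "word_pow (m + n) t = word_pow m t @ word_pow n t"
  by (simp add: replicate_add)

lemma word_pow_mult: "word_pow m (word_pow n t) = word_pow (m * n) t"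
  by (induction m) (simp_all add: word_pow_add)

lemma word_pow_commute: "word_pow m t @ word_pow n t = word_pow n t @ word_pow m t"
  by (metis word_pow_add add.commute)

lemma word_pow_Suc_right: "word_pow (Suc n) t = word_pow n t @ t"
  using word_pow_add[of n 1 t] by simp

lemma rev_word_pow: "rev (word_pow n t) = word_pow n (rev t)"
  by (simp add: rev_concat)

text \<open>For nonempty words this is equivalent to not being a proper power. The form through the
  centralizer is the one used below.\<close>

definition primitive_word :: "'a list \<Rightarrow> bool" where
  "primitive_word t \<longleftrightarrow> t \<noteq> [] \<and> (\<forall>w. w @ t = t @ w \<longrightarrow> (\<exists>n. w = word_pow n t))"

lemma primitive_wordD:
  assumes "primitive_word t" "w @ t = t @ w"
  obtains n where "w = word_pow n t"
  using assms by (auto simp: primitive_word_def)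

lemma primitive_word_rev: "primitive_word t \<Longrightarrow> primitive_word (rev t)"
  unfolding primitive_word_def
  by (metis rev_append rev_rev_ident rev_word_pow rev_is_Nil_conv)

text \<open>Take \<open>t\<close> as a shortest common root of \<open>u\<close> and
  \<open>v\<close>. If \<open>w\<close> commutes with \<open>t\<close>, both are powers of some
  \<open>z\<close>, which is again a common root, so minimality forces \<open>t = z\<close>.\<close>

lemma commuting_words_primitive_root:
  assumes "u @ v = v @ u" "u \<noteq> []"
  obtains t p q where "primitive_word t" "u = word_pow p t" "v = word_pow q t"
proof -
  define R where "R t \<longleftrightarrow> (\<exists>p q. u = word_pow p t \<and> v = word_pow q t)" for t :: "'a list"
  have "\<exists>t. R t"
    using comm_append_are_replicate[OF assms(1)] unfolding R_def by blast
  then obtain t where t: "R t" and least: "\<And>z. R z \<Longrightarrow> length t \<le> length z"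
    by (metis ex_has_least_nat)
  then obtain p q where pq: "u = word_pow p t" "v = word_pow q t"
    by (auto simp: R_def)
  have "t \<noteq> []"
    using pq assms(2) by auto
  moreover have "\<exists>n. w = word_pow n t" if com: "w @ t = t @ w" for w
  proof -
    obtain i j z where z: "word_pow i z = w" "word_pow j z = t"
      using comm_append_are_replicate[OF com] by blast
    have "R z"
      unfolding R_def using pq z by (metis word_pow_mult)
    then have "length t \<le> length z"
      by (rule least)
    moreover have "length t = j * length z"
      using z(2) by auto
    moreover have "j \<noteq> 0" "length t \<noteq> 0"
      using \<open>t \<noteq> []\<close> z(2) by auto
    ultimately have "j = 1"
      by (cases "j = 0 \<or> j = 1") (use mult_le_mono1[of 2 j "length z"] in auto)
    then show ?thesis using z by auto
  qed
  ultimately have "primitive_word t"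
    by (auto simp: primitive_word_def)
  with pq show ?thesis using that by blast
qed

section \<open>Free monoids generated by two words\<close>

definition xy_word :: "'a list \<Rightarrow> 'a list \<Rightarrow> xy list \<Rightarrow> 'a list" where
  "xy_word u v W = concat (map (case_xy u v) W)"

lemma xy_word_simps [simp]:
  "xy_word u v [] = []" "xy_word u v (X # W) = u @ xy_word u v W"
  "xy_word u v (Y # W) = v @ xy_word u v W" 
  "xy_word u v (V @ W) = xy_word u v V @ xy_word u v W"
  by (simp_all add: xy_word_def)

lemma length_xy_word: "length (xy_word u v W) = weight (length u) (length v) W"
  by (induction W) (auto simp: xy_word_def weight_def split: xy.split)

text \<open>Rewrite \<open>Y\<close> as \<open>X\<close> followed by \<open>Y\<close>; this is the
  Euclidean step of the next lemma.\<close>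

lemma xy_word_split:
  "\<exists>V'. xy_word u (u @ v) V = xy_word u v V'"
proof (induction V)
  case Nil
  then show ?case by (metis xy_word_simps(1))
next
  case (Cons a V)
  then obtain V' where "xy_word u (u @ v) V = xy_word u v V'" by auto
  then have "xy_word u (u @ v) (a # V) = xy_word u v (case a of X \<Rightarrow> X # V' | Y \<Rightarrow> X # Y # V')"
    by (cases a) auto
  then show ?case by blast
qed

text \<open>Euclid's algorithm on the lengths. If \<open>u\<close> is the shorter word, then
  \<open>v = u @ v'\<close>; after cancelling \<open>u\<close>, both sides are \<open>u\<close>,
  respectively \<open>v'\<close>, followed by a word over \<open>u\<close> and
  \<open>v'\<close>.\<close>

lemma commute_if_words_meet:
  assumes "u @ xy_word u v V = v @ xy_word u v W" "u \<noteq> []" "v \<noteq> []"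
  shows "u @ v = v @ u"
  using assms
proof (induction "length u + length v" arbitrary: u v V W rule: less_induct)
  case less
  have main: "u @ v = v @ u"
    if len: "length u \<le> length v" and eq: "u @ xy_word u v V = v @ xy_word u v W"
      and ne: "u \<noteq> []" "v \<noteq> []" 
      and IH: "\<And>v' V W. length v' < length v \<Longrightarrow> u @ xy_word u v' V = v' @ xy_word u v' W \<Longrightarrow> v' \<noteq> [] \<Longrightarrow> u @ v' = v' @ u"
    for u v :: "'a list" and V W
  proof -
    obtain v' where v: "v = u @ v'"
      using eq len by (metis append_eq_append_conv_if append_take_drop_id)
    show ?thesis
    proof (cases "v' = []")
      case True
      then show ?thesis using v by simp
    next
      case False
      have e: "xy_word u v V = v' @ xy_word u v W"
        using eq v by simp
      obtain W' where W': "xy_word u v W = xy_word u v' W'"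
        using xy_word_split v by metis
      have "V \<noteq> []" using e False by auto
      then obtain a V1 where V: "V = a # V1" by (cases V) auto
      obtain V1' where V1': "xy_word u v V1 = xy_word u v' V1'"
        using xy_word_split v by metis
      have "xy_word u v V = u @ xy_word u v' (case a of X \<Rightarrow> V1' | Y \<Rightarrow> Y # V1')"
        using V V1' v by (cases a) auto
      then have "u @ xy_word u v' (case a of X \<Rightarrow> V1' | Y \<Rightarrow> Y # V1') = v' @ xy_word u v' W'"
        using e W' by simp
      then have "u @ v' = v' @ u"
        using IH False v ne(1) by (metis length_append length_greater_0_conv less_add_same_cancel2)
      then show ?thesis using v by simp
    qed
  qed
  \<comment> \<open>Exchanging the letters reduces the case where \<open>v\<close> is shorter to
    \<open>main\<close>.\<close>
  define sw where "sw = map (case_xy Y X)"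
  have sw: "xy_word u v W = xy_word v u (sw W)" for u v :: "'a list" and W
    by (induction W) (auto simp: sw_def xy_word_def split: xy.split)
  show ?case
  proof (cases "length u \<le> length v")
    case True
    show ?thesis
      by (rule main[OF True less.prems]) (use less in auto)
  next
    case False
    have "v @ u = u @ v"
    proof (rule main)
      show "v @ xy_word v u (sw W) = u @ xy_word v u (sw V)"
        using less.prems(1) sw by metis
      fix u' V W
      assume a: "length u' < length u" "v @ xy_word v u' V = u' @ xy_word v u' W" "u' \<noteq> []"
      then have "u' @ xy_word u' v (sw W) = v @ xy_word u' v (sw V)"
        using sw by metis
      then show "v @ u' = u' @ v"
        using less.hyps[of u' v] a less.prems by auto
    qed (use False less.prems in auto)
    then show ?thesis by simp
  qed
qed

lemma inj_xy_word:
  assumes "u @ v \<noteq> v @ u"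
  shows "inj (xy_word u v)"
proof (rule injI)
  have ne: "u \<noteq> []" "v \<noteq> []" using assms by auto
  show "V = W" if "xy_word u v V = xy_word u v W" for V W
    using that
  proof (induction V arbitrary: W)
    case Nil
    show ?case
    proof (cases W)
      case (Cons a W')
      then show ?thesis using Nil ne by (cases a) auto
    qed simp
  next
    case (Cons a V)
    show ?case
    proof (cases W)
      case Nil
      then show ?thesis using Cons ne by (cases a) auto
    next
      case (Cons b W')
      have "a = b"
        using Cons.prems assms ne commute_if_words_meet[of u v V W'] commute_if_words_meet[of u v W' V]
        by (cases a; cases b) (auto simp: Cons)
      then show ?thesis
        using Cons Cons.prems Cons.IH[of W'] by (cases b) auto
    qed
  qed
qed

section \<open>Monomial orders and leading words\<close>

lemma finite_nat_maximizer:
  fixes h :: "'b \<Rightarrow> nat"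
  assumes "finite A" "A \<noteq> {}"
  shows "\<exists>i\<in>A. \<forall>j\<in>A. h j \<le> h i"
proof -
  have "Max (h ` A) \<in> h ` A"
    using assms by simp
  then obtain i where "i \<in> A" "Max (h ` A) = h i"
    by auto
  then show ?thesis
    using Max_ge[of "h ` A"] assms(1) by (metis finite_imageI imageI)
qed

text \<open>Coding words injectively by numbers makes the order total and well founded at once, so
  maxima over supports and inductions on leading words take place in \<open>nat\<close>. The order
  obtained by comparing reversed words is again an instance.\<close>

locale word_order =
  fixes code :: "'a list \<Rightarrow> nat"
  assumes code_inj: "code u = code v \<Longrightarrow> u = v"
    and code_append_left: "code u < code v \<Longrightarrow> code (w @ u) < code (w @ v)"
    and code_append_right: "code u < code v \<Longrightarrow> code (u @ w) < code (v @ w)"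
    and code_length: "code u < code v \<Longrightarrow> length u \<le> length v"
begin

lemma code_le_length: "code u \<le> code v \<Longrightarrow> length u \<le> length v"
  using code_length code_inj by (metis le_neq_implies_less order_refl)

lemma code_less_if_length: "length u < length v \<Longrightarrow> code u < code v"
  using code_le_length by (meson leD not_le_imp_less)

lemma code_append_left_le: "code u \<le> code v \<Longrightarrow> code (w @ u) \<le> code (w @ v)"
  using code_append_left code_inj by (metis le_eq_less_or_eq)

lemma code_append_strict_left: "code u < code u' \<Longrightarrow> code v \<le> code v' \<Longrightarrow> code (u @ v) < code (u' @ v')"
  by (meson code_append_left_le code_append_right le_less_trans less_le_trans)

text \<open>Carry \<open>s\<close> past one copy of \<open>t\<close> at a time.\<close>

lemma code_word_pow_less:
  assumes "code (s @ t) < code (t @ s)" "n > 0"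
  shows "code (s @ word_pow n t) < code (word_pow n t @ s)"
  using assms(2)
proof (induction n)
  case (Suc n)
  show ?case
  proof (cases "n = 0")
    case True
    then show ?thesis using assms(1) by simp
  next
    case False
    have "code ((s @ word_pow n t) @ t) < code ((word_pow n t @ s) @ t)"
      using Suc.IH False code_append_right by blast
    also have "\<dots> < code (word_pow n t @ t @ s)"
      using code_append_left[OF assms(1), of "word_pow n t"] by simp
    finally show ?thesis by (simp add: word_pow_Suc_right del: replicate_Suc concat.simps(2))
  qed
qed simp

lemma code_word_pow_greater:
  assumes "code (t @ s) < code (s @ t)" "n > 0"
  shows "code (word_pow n t @ s) < code (s @ word_pow n t)"
  using assms(2)
proof (induction n)
  case (Suc n)
  show ?case
  proof (cases "n = 0")
    case True
    then show ?thesis using assms(1) by simp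
  next
    case False
    have "code ((word_pow n t @ t) @ s) < code (word_pow n t @ s @ t)"
      using code_append_left[OF assms(1), of "word_pow n t"] by simp
    also have "\<dots> < code ((s @ word_pow n t) @ t)"
      using code_append_right[of "word_pow n t @ s" "s @ word_pow n t" t] Suc.IH False by simp
    finally show ?thesis by (simp add: word_pow_Suc_right del: replicate_Suc concat.simps(2))
  qed
qed simp

text \<open>If \<open>s\<close> and \<open>t\<close> did not commute, one of \<open>s @ t\<close>
  and \<open>t @ s\<close> would be strictly smaller, and this strict comparison persists for powers
  of \<open>t\<close>.\<close>

lemma commute_if_commute_word_pow:
  fixes s t :: "'a list"
  assumes "s @ word_pow n t = word_pow n t @ s" "n > 0"
  shows "s @ t = t @ s"
proof (rule ccontr)
  assume "s @ t \<noteq> t @ s"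
  then have "code (s @ t) < code (t @ s) \<or> code (t @ s) < code (s @ t)"
    using code_inj by (meson linorder_neqE_nat)
  then show False
    using code_word_pow_less[of s t n] code_word_pow_greater[of t s n] assms by auto
qed

text \<open>\<open>leads w c f\<close> allows \<open>c = 0\<close>, in which case \<open>f\<close> only involves words below \<open>w\<close>.\<close>

definition leads :: "'a list \<Rightarrow> 'k \<Rightarrow> ('a, 'k::field) free_algebra \<Rightarrow> bool" where
  "leads w c f \<longleftrightarrow> Poly_Mapping.lookup f w = c \<and> (\<forall>x\<in>Poly_Mapping.keys f. code x \<le> code w)"

text \<open>For \<open>f = 0\<close> this is an arbitrary word; \<open>lc f\<close> is then still
  0.\<close>

definition lw :: "('a, 'k::field) free_algebra \<Rightarrow> 'a list" where
  "lw f = (SOME w. w \<in> Poly_Mapping.keys f \<and> (\<forall>x\<in>Poly_Mapping.keys f. code x \<le> code w))"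

abbreviation lc :: "('a, 'k::field) free_algebra \<Rightarrow> 'k" where
  "lc f \<equiv> Poly_Mapping.lookup f (lw f)"

lemma lw_props:
  assumes "f \<noteq> 0"
  shows "lw f \<in> Poly_Mapping.keys f" "x \<in> Poly_Mapping.keys f \<Longrightarrow> code x \<le> code (lw f)"
proof -
  have "\<exists>w. w \<in> Poly_Mapping.keys f \<and> (\<forall>x\<in>Poly_Mapping.keys f. code x \<le> code w)"
    using finite_nat_maximizer[of "Poly_Mapping.keys f" code] assms by auto
  then have *: "lw f \<in> Poly_Mapping.keys f \<and> (\<forall>x\<in>Poly_Mapping.keys f. code x \<le> code (lw f))"
    unfolding lw_def by (rule someI_ex)
  show "lw f \<in> Poly_Mapping.keys f" "x \<in> Poly_Mapping.keys f \<Longrightarrow> code x \<le> code (lw f)"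
    using * by auto
qed

lemma leads_lw: "f \<noteq> 0 \<Longrightarrow> leads (lw f) (lc f) f"
  using lw_props by (auto simp: leads_def)

lemma lc_nonzero: "f \<noteq> 0 \<Longrightarrow> lc f \<noteq> 0"
  using lw_props(1) by (auto simp: in_keys_iff)

lemma leads_imp_lw:
  assumes "leads w c f" "c \<noteq> 0"
  shows "f \<noteq> 0" "lw f = w" "lc f = c"
proof -
  have w: "w \<in> Poly_Mapping.keys f"
    using assms by (auto simp: leads_def in_keys_iff)
  then show f: "f \<noteq> 0" by auto
  show lw: "lw f = w"
    using lw_props[OF f] w assms(1) by (intro code_inj) (auto simp: leads_def intro: le_antisym)
  show "lc f = c"
    using lw assms(1) by (auto simp: leads_def)
qed

lemma leads_zero [simp]: "leads w 0 0"
  by (simp add: leads_def)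

lemma leads_single [simp]: "leads w c (Poly_Mapping.single w c)"
  by (auto simp: leads_def split: if_splits)

lemma leads_add: "leads w c f \<Longrightarrow> leads w d g \<Longrightarrow> leads w (c + d) (f + g)"
  using Poly_Mapping.keys_add[of f g] by (fastforce simp: leads_def lookup_add)

lemma leads_uminus: "leads w c f \<Longrightarrow> leads w (- c) (- f)"
  by (auto simp: leads_def)

lemma leads_diff: "leads w c f \<Longrightarrow> leads w d g \<Longrightarrow> leads w (c - d) (f - g)"
  using leads_add[of w c f "- d" "- g"] leads_uminus[of w d g] by simp

lemma leads_sum:
  "(\<And>i. i \<in> I \<Longrightarrow> leads w (c i) (f i)) \<Longrightarrow> leads w (\<Sum>i\<in>I. c i) (\<Sum>i\<in>I. f i)"
  by (induction I rule: infinite_finite_induct) (auto intro: leads_add)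

lemma leads_lower: "leads w c f \<Longrightarrow> code w < code w' \<Longrightarrow> leads w' 0 f"
  by (force simp: leads_def in_keys_iff)

lemma leads_zero_keys: "leads w 0 f \<Longrightarrow> x \<in> Poly_Mapping.keys f \<Longrightarrow> code x < code w"
  using code_inj by (metis in_keys_iff le_neq_implies_less leads_def)

lemma leads_zeroE:
  assumes "leads w 0 f"
  shows "f = 0 \<or> code (lw f) < code w"
proof (cases "f = 0")
  case False
  have "lw f \<noteq> w"
    using lw_props(1)[OF False] assms by (auto simp: leads_def in_keys_iff)
  then show ?thesis
    using lw_props(1)[OF False] assms code_inj
    by (metis le_neq_implies_less leads_def)
qed simp

lemma leads_zero_if_lw_less: "code (lw f) < code w \<Longrightarrow> leads w 0 f"
  by (cases "f = 0") (auto intro: leads_lower[OF leads_lw])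

text \<open>Split off the terms at \<open>w\<close> and \<open>v\<close>; all words in the remaining
  products lie strictly below \<open>w @ v\<close>.\<close>

lemma leads_mult:
  assumes "leads w c f" "leads v d g"
  shows "leads (w @ v) (c * d) (f * g)"
proof -
  have keys: "\<exists>a b. x = a @ b \<and> a \<in> Poly_Mapping.keys p \<and> b \<in> Poly_Mapping.keys q"
    if "x \<in> Poly_Mapping.keys (p * q)" for x and p q :: "('a, 'b) free_algebra"
    using keys_mult[of p q] that by (auto simp: plus_list_def)
  define f' where "f' = f - Poly_Mapping.single w c"
  define g' where "g' = g - Poly_Mapping.single v d"
  have f': "code x < code w" if "x \<in> Poly_Mapping.keys f'" for x
    using leads_zero_keys[of w f' x] leads_diff[OF assms(1) leads_single, of c] that by (simp add: f'_def)
  have g': "code x < code v" if "x \<in> Poly_Mapping.keys g'" for x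
    using leads_zero_keys[of v g' x] leads_diff[OF assms(2) leads_single, of d] that by (simp add: g'_def)
  have "f * g = Poly_Mapping.single w c * Poly_Mapping.single v d + (Poly_Mapping.single w c * g' + f' * g)"
    by (simp add: f'_def g'_def algebra_simps)
  moreover have "leads (w @ v) (c * d) (Poly_Mapping.single w c * Poly_Mapping.single v d)"
    using leads_single by (simp add: mult_single plus_list_def)
  moreover have "leads (w @ v) 0 (Poly_Mapping.single w c * g')"
  proof -
    have "code x < code (w @ v)" if "x \<in> Poly_Mapping.keys (Poly_Mapping.single w c * g')" for x
      using keys[OF that] g' code_append_left by (auto split: if_splits)
    then show ?thesis by (force simp: leads_def in_keys_iff)
  qed
  moreover have "leads (w @ v) 0 (f' * g)"
  proof -
    have "code x < code (w @ v)" if "x \<in> Poly_Mapping.keys (f' * g)" for x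
      using keys[OF that] f' assms(2) code_append_strict_left by (auto simp: leads_def)
    then show ?thesis by (force simp: leads_def in_keys_iff)
  qed
  ultimately show ?thesis
    by (metis leads_add add_0_right)
qed

lemma lw_mult:
  assumes "f \<noteq> 0" "g \<noteq> 0"
  shows "f * g \<noteq> 0" "lw (f * g) = lw f @ lw g" "lc (f * g) = lc f * lc g"
proof -
  have "lc f * lc g \<noteq> 0"
    using lc_nonzero assms by auto
  note * = leads_imp_lw[OF leads_mult[OF leads_lw[OF assms(1)] leads_lw[OF assms(2)]] this]
  show "f * g \<noteq> 0" "lw (f * g) = lw f @ lw g" "lc (f * g) = lc f * lc g"
    by (fact *)+
qed

lemma lw_diff:
  assumes "f \<noteq> 0" "code (lw g) < code (lw f)"
  shows "f - g \<noteq> 0" "lw (f - g) = lw f"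
  using leads_imp_lw[OF leads_diff[OF leads_lw[OF assms(1)] leads_zero_if_lw_less[OF assms(2)]]]
    lc_nonzero[OF assms(1)] by auto

lemma lw_diff':
  assumes "f \<noteq> 0" "code (lw g) < code (lw f)"
  shows "g - f \<noteq> 0" "lw (g - f) = lw f"
  using leads_imp_lw[OF leads_diff[OF leads_zero_if_lw_less[OF assms(2)] leads_lw[OF assms(1)]]]
    lc_nonzero[OF assms(1)] by auto

lemma leads_power: "leads w c f \<Longrightarrow> leads (word_pow n w) (c ^ n) (f ^ n)"
proof (induction n)
  case 0
  then show ?case by (simp add: leads_def lookup_one zero_list_def)
qed (auto intro: leads_mult)

lemma lw_power:
  assumes "f \<noteq> 0"
  shows "f ^ n \<noteq> 0" "lw (f ^ n) = word_pow n (lw f)" "lc (f ^ n) = lc f ^ n"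
proof -
  have "lc f ^ n \<noteq> 0"
    using lc_nonzero assms by auto
  note * = leads_imp_lw[OF leads_power[OF leads_lw[OF assms]] this]
  show "f ^ n \<noteq> 0" "lw (f ^ n) = word_pow n (lw f)" "lc (f ^ n) = lc f ^ n"
    by (fact *)+
qed

lemma deg_lw: "f \<noteq> 0 \<Longrightarrow> deg f = length (lw f)"
  unfolding deg_def by (auto intro!: Max_eqI intro: code_le_length lw_props)

text \<open>The greatest of the distinct leading words comes from a single summand, so it cannot
  cancel.\<close>

lemma lw_sum:
  assumes "finite I" "I \<noteq> {}" "\<And>i. i \<in> I \<Longrightarrow> f i \<noteq> 0" "inj_on (\<lambda>i. lw (f i)) I"
  shows "sum f I \<noteq> 0" "\<exists>i\<in>I. lw (sum f I) = lw (f i)"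
    "\<And>i. i \<in> I \<Longrightarrow> code (lw (f i)) \<le> code (lw (sum f I))"
proof -
  obtain i where i: "i \<in> I" "\<And>j. j \<in> I \<Longrightarrow> code (lw (f j)) \<le> code (lw (f i))"
    using finite_nat_maximizer[OF assms(1,2), of "\<lambda>i. code (lw (f i))"] by blast
  have "leads (lw (f i)) 0 (sum f (I - {i}))"
  proof -
    have "leads (lw (f i)) 0 (f j)" if "j \<in> I - {i}" for j
    proof (rule leads_zero_if_lw_less)
      have "lw (f j) \<noteq> lw (f i)"
        using assms(4) that i(1) by (auto dest: inj_onD)
      then show "code (lw (f j)) < code (lw (f i))"
        using i(2)[of j] that code_inj by (metis DiffD1 le_neq_implies_less)
    qed
    then have "leads (lw (f i)) (\<Sum>j\<in>I - {i}. 0) (sum f (I - {i}))"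
      by (intro leads_sum)
    then show ?thesis by simp
  qed
  then have "leads (lw (f i)) (lc (f i) + 0) (f i + sum f (I - {i}))"
    by (intro leads_add leads_lw assms(3) i(1))
  then have "leads (lw (f i)) (lc (f i)) (sum f I)"
    using assms(1) i(1) by (simp add: sum.remove)
  note * = leads_imp_lw[OF this lc_nonzero[OF assms(3)[OF i(1)]]]
  show "sum f I \<noteq> 0" "\<exists>i\<in>I. lw (sum f I) = lw (f i)"
    "\<And>j. j \<in> I \<Longrightarrow> code (lw (f j)) \<le> code (lw (sum f I))"
    using * i by auto
qed

end

section \<open>Substitution into the free algebra on two letters\<close>

lemma poly_mapping_sum_singles:
  "f = (\<Sum>k\<in>Poly_Mapping.keys f. Poly_Mapping.single k (Poly_Mapping.lookup f k))"
proof (rule poly_mapping_eqI)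
  fix k
  have "Poly_Mapping.lookup (\<Sum>k\<in>Poly_Mapping.keys f. Poly_Mapping.single k (Poly_Mapping.lookup f k)) k
      = (\<Sum>l\<in>Poly_Mapping.keys f. if l = k then Poly_Mapping.lookup f k else 0)"
    by (auto simp: lookup_sum lookup_single when_def intro!: sum.cong)
  also have "\<dots> = Poly_Mapping.lookup f k"
    by (simp add: in_keys_iff)
  finally show "Poly_Mapping.lookup f k =
      Poly_Mapping.lookup (\<Sum>k\<in>Poly_Mapping.keys f. Poly_Mapping.single k (Poly_Mapping.lookup f k)) k"
    by simp
qed

lemma scalar_single: "scalar c * Poly_Mapping.single w d = Poly_Mapping.single w (c * d)"
  by (simp add: scalar_def mult_single plus_list_def)

lemma lookup_scalar_mult [simp]: "Poly_Mapping.lookup (scalar c * f) w = c * Poly_Mapping.lookup f w"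
proof -
  have "scalar c * f = (\<Sum>k\<in>Poly_Mapping.keys f. Poly_Mapping.single k (c * Poly_Mapping.lookup f k))"
    by (subst poly_mapping_sum_singles[of f]) (simp add: sum_distrib_left scalar_single)
  then have "Poly_Mapping.lookup (scalar c * f) w
      = (\<Sum>l\<in>Poly_Mapping.keys f. if l = w then c * Poly_Mapping.lookup f w else 0)"
    by (auto simp: lookup_sum lookup_single when_def intro!: sum.cong)
  then show ?thesis by (simp add: in_keys_iff)
qed

lemma scalar_commute: "f * scalar c = scalar c * f"
proof -
  have "f * scalar c = (\<Sum>k\<in>Poly_Mapping.keys f. Poly_Mapping.single k (c * Poly_Mapping.lookup f k))"
    by (subst poly_mapping_sum_singles[of f])
      (simp add: sum_distrib_right scalar_def mult_single plus_list_def mult.commute)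
  also have "\<dots> = scalar c * f"
    by (subst (3) poly_mapping_sum_singles[of f]) (simp add: sum_distrib_left scalar_single)
  finally show ?thesis .
qed

lemma scalar_left_commute: "f * (scalar c * g) = scalar c * (f * g)"
  by (metis mult.assoc scalar_commute)

lemma scalar_simps:
  "scalar (c + d) = scalar c + scalar d" "scalar (c * d) = scalar c * scalar d"
  "scalar 0 = 0" "scalar 1 = 1" "scalar (- c) = - scalar c"
  by (simp_all add: scalar_def single_add single_uminus mult_single plus_list_def zero_list_def flip: single_one)

abbreviation word_val :: "('a, 'k::field) free_algebra \<Rightarrow> ('a, 'k) free_algebra \<Rightarrow> xy list \<Rightarrow> ('a, 'k) free_algebra" where
  "word_val f g W \<equiv> prod_list (map (case_xy f g) W)"

lemma subst_xy_superset:
  assumes "finite S" "Poly_Mapping.keys P \<subseteq> S"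
  shows "subst_xy f g P = (\<Sum>W\<in>S. scalar (Poly_Mapping.lookup P W) * word_val f g W)"
  unfolding subst_xy_def using assms
  by (intro sum.mono_neutral_left) (auto simp: in_keys_iff scalar_simps)

lemma subst_xy_add: "subst_xy f g (P + Q) = subst_xy f g P + subst_xy f g Q"
proof -
  have "Poly_Mapping.keys (P + Q) \<subseteq> Poly_Mapping.keys P \<union> Poly_Mapping.keys Q"
    by (rule Poly_Mapping.keys_add)
  then show ?thesis
    by (simp add: subst_xy_superset[of "Poly_Mapping.keys P \<union> Poly_Mapping.keys Q"] lookup_add
        scalar_simps algebra_simps sum.distrib)
qed

lemma subst_xy_zero [simp]: "subst_xy f g 0 = 0"
  by (simp add: subst_xy_def)

lemma subst_xy_sum: "subst_xy f g (\<Sum>i\<in>I. P i) = (\<Sum>i\<in>I. subst_xy f g (P i))"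
  by (induction I rule: infinite_finite_induct) (auto simp: subst_xy_add)

lemma subst_xy_single: "subst_xy f g (Poly_Mapping.single W c) = scalar c * word_val f g W"
  by (cases "c = 0") (auto simp: subst_xy_def scalar_simps)

lemma subst_xy_scalar_mult: "subst_xy f g (scalar c * P) = scalar c * subst_xy f g P"
proof -
  have "Poly_Mapping.keys (scalar c * P) \<subseteq> Poly_Mapping.keys P"
    by (auto simp: in_keys_iff)
  then show ?thesis
    by (simp add: subst_xy_superset[of "Poly_Mapping.keys P"] scalar_simps sum_distrib_left mult.assoc)
qed

lemma subst_xy_commutator:
  "subst_xy f g (commutator (Poly_Mapping.single [X] 1) (Poly_Mapping.single [Y] 1)) = commutator f g"
proof -
  have "commutator (Poly_Mapping.single [X] 1) (Poly_Mapping.single [Y] 1)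
      = Poly_Mapping.single [X, Y] (1 :: 'b) + Poly_Mapping.single [Y, X] (- 1)"
    by (simp add: commutator_def mult_single plus_list_def single_uminus)
  then show ?thesis
    by (simp only: subst_xy_add subst_xy_single scalar_simps) (simp add: commutator_def)
qed

lemma commutator_add: "commutator h (p + q) = commutator h p + commutator h q"
  by (simp add: commutator_def algebra_simps)

lemma commutator_zero [simp]: "commutator h 0 = 0"
  by (simp add: commutator_def)

lemma commutator_sum: "commutator h (\<Sum>i\<in>I. p i) = (\<Sum>i\<in>I. commutator h (p i))"
  by (induction I rule: infinite_finite_induct) (auto simp: commutator_add)

lemma commutator_scalar_mult: "commutator h (scalar c * p) = scalar c * commutator h p"
  by (simp add: commutator_def algebra_simps scalar_left_commute)

lemma commutator_mult: "commutator h (p * q) = commutator h p * q + p * commutator h q"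
  by (simp add: commutator_def algebra_simps)

text \<open>The map \<open>commutator h\<close> is a derivation that kills \<open>f\<close>, so by
  the Leibniz rule only the occurrences of \<open>Y\<close> contribute.\<close>

lemma commutator_word_val:
  assumes "commutator h f = 0"
  shows "commutator h (word_val f g W) = (\<Sum>i<length W.
    if W ! i = Y then word_val f g (take i W) * commutator h g * word_val f g (drop (Suc i) W) else 0)"
proof (induction W)
  case Nil
  then show ?case by (simp add: commutator_def)
next
  case (Cons a W)
  have *: "(\<Sum>i<length (a # W). if (a # W) ! i = Y then word_val f g (take i (a # W)) * commutator h g * word_val f g (drop (Suc i) (a # W)) else 0)
    = (if a = Y then commutator h g * word_val f g W else 0) + (case a of X \<Rightarrow> f | Y \<Rightarrow> g) * commutator h (word_val f g W)"
    unfolding Cons.IH sum_distrib_left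
    by (simp add: sum.lessThan_Suc_shift mult.assoc if_distrib cong: if_cong del: sum.lessThan_Suc)
  show ?case
    unfolding * using assms by (cases a) (simp_all add: commutator_mult)
qed

definition linear_subspace :: "('a, 'k::field) free_algebra set \<Rightarrow> bool" where
  "linear_subspace V \<longleftrightarrow> 0 \<in> V \<and> (\<forall>p\<in>V. \<forall>q\<in>V. p + q \<in> V) \<and> (\<forall>c. \<forall>p\<in>V. scalar c * p \<in> V)"

context word_order
begin

lemma leads_scalar: "leads w c f \<Longrightarrow> leads w (d * c) (scalar d * f)"
  by (auto simp: leads_def in_keys_iff)

lemma scalar_if_lw_Nil:
  assumes "lw f = []"
  shows "\<exists>c. f = scalar c"
proof (cases "f = 0")
  case True
  then show ?thesis by (metis scalar_simps(3))
next
  case False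
  have "x = []" if "x \<in> Poly_Mapping.keys f" for x
    using lw_props(2)[OF False that] code_le_length[of x "[]"] assms by auto
  then have "f = Poly_Mapping.single [] (Poly_Mapping.lookup f [])"
    by (intro poly_mapping_eqI) (metis in_keys_iff lookup_single_eq lookup_single_not_eq)
  then show ?thesis
    unfolding scalar_def by blast
qed

section \<open>Leading words of commutators\<close>

lemma lw_commutator:
  assumes "f \<noteq> 0" "g \<noteq> 0" 
  shows "code (lw g @ lw f) < code (lw f @ lw g) \<Longrightarrow> commutator f g \<noteq> 0"
    "code (lw g @ lw f) < code (lw f @ lw g) \<Longrightarrow> lw (commutator f g) = lw f @ lw g"
    "code (lw f @ lw g) < code (lw g @ lw f) \<Longrightarrow> commutator f g \<noteq> 0"
    "code (lw f @ lw g) < code (lw g @ lw f) \<Longrightarrow> lw (commutator f g) = lw g @ lw f"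
  unfolding commutator_def
  using lw_mult[OF assms] lw_mult[OF assms(2,1)] lw_diff[of "f * g" "g * f"] lw_diff'[of "g * f" "f * g"]
  by auto

lemma deg_commutator_le:
  fixes f g :: "('a, 'k::field) free_algebra"
  assumes "f \<noteq> 0" "g \<noteq> 0"
  shows "deg (commutator f g) \<le> deg f + deg g"
proof (cases "commutator f g = 0")
  case True
  then show ?thesis by (simp add: deg_def)
next
  case False
  let ?y = "lw (commutator f g)"
  have "?y \<in> Poly_Mapping.keys (f * g) \<or> ?y \<in> Poly_Mapping.keys (g * f)"
    using lw_props(1)[OF False] keys_diff[of "f * g" "g * f"] unfolding commutator_def by blast
  then have "code ?y \<le> code (lw f @ lw g) \<or> code ?y \<le> code (lw g @ lw f)"
    using lw_mult(1,2)[OF assms] lw_mult(1,2)[OF assms(2,1)] lw_props(2) by metis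
  then have "length ?y \<le> length (lw f) + length (lw g)"
    using code_le_length by fastforce
  then show ?thesis
    by (simp add: deg_lw assms False)
qed

text \<open>By the Leibniz rule the commutator is the sum of the \<open>n + 1\<close> products
  \<open>a ^ i * commutator a g * a ^ (n - i)\<close>. Powers of \<open>t\<close> commute, so all of
  them have the same candidate leading word and their coefficients add up. The factor
  \<open>n + 1\<close> may vanish in the field, which \<open>leads\<close> allows.\<close>

lemma leads_commutator_power:
  assumes "leads (word_pow j t) c a" "leads (word_pow k t) d (commutator a g)"
  shows "leads (word_pow (n * j + k) t) (of_nat (Suc n) * c ^ n * d) (commutator (a ^ Suc n) g)"
proof (induction n)
  case 0
  then show ?case using assms by simp
next
  case (Suc n)
  have *: "commutator (a ^ Suc (Suc n)) g = a * commutator (a ^ Suc n) g + commutator a g * a ^ Suc n"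
    by (simp add: commutator_def algebra_simps)
  have "leads (word_pow j t @ word_pow (n * j + k) t) (c * (of_nat (Suc n) * c ^ n * d)) (a * commutator (a ^ Suc n) g)"
    using Suc.IH assms(1) leads_mult by blast
  moreover have "leads (word_pow k t @ word_pow (Suc n) (word_pow j t)) (d * c ^ Suc n) (commutator a g * a ^ Suc n)"
    using assms leads_mult leads_power by blast
  moreover have "word_pow j t @ word_pow (n * j + k) t = word_pow (Suc n * j + k) t"
    by (simp add: algebra_simps flip: word_pow_add)
  moreover have "word_pow k t @ word_pow (Suc n) (word_pow j t) = word_pow (Suc n * j + k) t"
    unfolding word_pow_mult by (simp add: algebra_simps flip: word_pow_add)
  ultimately have "leads (word_pow (Suc n * j + k) t) (c * (of_nat (Suc n) * c ^ n * d) + d * c ^ Suc n)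
      (commutator (a ^ Suc (Suc n)) g)"
    unfolding * by (metis leads_add)
  then show ?case
    by (simp add: algebra_simps)
qed

lemma commute_if_append_word_pow:
  fixes s t :: "'a list"
  assumes "s @ word_pow q t = word_pow K t \<or> word_pow q t @ s = word_pow K t"
  shows "s @ t = t @ s"
proof -
  have K: "word_pow K t @ t = t @ word_pow K t" and q: "word_pow q t @ t = t @ word_pow q t"
    using word_pow_commute[of _ t 1] by auto
  show ?thesis
    using assms
  proof
    assume "s @ word_pow q t = word_pow K t"
    then have "(s @ t) @ word_pow q t = (t @ s) @ word_pow q t"
      using K q by (metis append.assoc)
    then show ?thesis by blast
  next
    assume "word_pow q t @ s = word_pow K t"
    then have "word_pow q t @ (s @ t) = word_pow q t @ (t @ s)"
      using K q by (metis append.assoc)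
    then show ?thesis by blast
  qed
qed

text \<open>Subtracting a multiple of a power of \<open>g\<close> removes the leading term of
  \<open>a ^ Suc n\<close> without changing the commutator with \<open>g\<close>. So
  \<open>b\<close> has a smaller leading word, while the leading word of its commutator is the one
  given by \<open>leads_commutator_power\<close>: the gap between \<open>i + q\<close> and
  \<open>n * j + k\<close> is smaller than the gap between \<open>j + q\<close> and
  \<open>k\<close>.\<close>

lemma commutator_descent:
  fixes a g :: "('a, 'k::field) free_algebra"
  assumes t: "primitive_word t"
    and a: "a \<noteq> 0" "lw a = word_pow j t" and g: "g \<noteq> 0" "lw g = word_pow q t" "q > 0"
    and comm: "commutator a g \<noteq> 0" "lw (commutator a g) = word_pow k t"
    and Q: "Suc n * j = J * q" "of_nat (Suc n) \<noteq> (0 :: 'k)"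
  obtains b i where "b \<noteq> 0" "lw b = word_pow i t" "0 < i" "i < Suc n * j"
    "commutator b g \<noteq> 0" "lw (commutator b g) = word_pow (n * j + k) t"
proof -
  define c where "c = lc a ^ Suc n / lc g ^ J"
  define b where "b = a ^ Suc n - scalar c * g ^ J"
  have "leads (word_pow (Suc n * j) t) (lc a ^ Suc n) (a ^ Suc n)"
    using leads_power[OF leads_lw[OF a(1)], of "Suc n"] by (simp only: a(2) word_pow_mult)
  moreover have "leads (word_pow (J * q) t) (lc g ^ J) (g ^ J)"
    using leads_power[OF leads_lw[OF g(1)], of J] by (simp only: g(2) word_pow_mult)
  then have "leads (word_pow (Suc n * j) t) (c * lc g ^ J) (scalar c * g ^ J)"
    using leads_scalar Q(1) by metis
  ultimately have b0: "leads (word_pow (Suc n * j) t) 0 b"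
    unfolding b_def using leads_diff lc_nonzero[OF g(1)] by (fastforce simp: c_def)
  have "g ^ J * g = g * g ^ J"
    by (rule power_commutes)
  then have "commutator b g = commutator (a ^ Suc n) g"
    by (simp add: b_def commutator_def algebra_simps scalar_left_commute mult.assoc)
  then have "leads (word_pow (n * j + k) t) (of_nat (Suc n) * lc a ^ n * lc (commutator a g)) (commutator b g)"
    using leads_commutator_power leads_lw[OF a(1)] leads_lw[OF comm(1)] a(2) comm(2) by metis
  moreover have "of_nat (Suc n) * lc a ^ n * lc (commutator a g) \<noteq> 0"
    using Q(2) lc_nonzero a(1) comm(1) by auto
  ultimately have bg: "commutator b g \<noteq> 0" "lw (commutator b g) = word_pow (n * j + k) t"
    using leads_imp_lw by blast+
  then have "b \<noteq> 0" by (auto simp: commutator_def)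
  then have small: "code (lw b) < code (word_pow (Suc n * j) t)"
    using leads_zeroE[OF b0] by auto
  \<comment> \<open>Otherwise \<open>lw b\<close> does not commute with \<open>lw g\<close> either,
    and the leading word of \<open>commutator b g\<close> is a product of the two. As this product
    is a power of \<open>t\<close>, the word \<open>lw b\<close> commutes with \<open>t\<close>
    after all.\<close>
  have "lw b @ t = t @ lw b"
  proof (rule ccontr)
    assume "lw b @ t \<noteq> t @ lw b"
    then have "lw b @ lw g \<noteq> lw g @ lw b"
      using g commute_if_commute_word_pow by metis
    then have "lw (commutator b g) = lw b @ lw g \<or> lw (commutator b g) = lw g @ lw b"
      using lw_commutator[OF \<open>b \<noteq> 0\<close> g(1)] code_inj by (meson linorder_neqE_nat)
    then show False
      using \<open>lw b @ t \<noteq> t @ lw b\<close> commute_if_append_word_pow[of "lw b" q t "n * j + k"] bg(2) g(2) by metis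
  qed
  then obtain i where i: "lw b = word_pow i t"
    using t primitive_wordD by metis
  have "i < Suc n * j"
  proof (rule ccontr)
    assume "\<not> i < Suc n * j"
    then obtain r where r: "i = Suc n * j + r"
      by (metis le_Suc_ex not_less)
    have "code (word_pow (Suc n * j) t @ []) \<le> code (word_pow (Suc n * j) t @ word_pow r t)"
      by (intro code_append_left_le) (metis code_le_length le_zero_eq length_0_conv linear list.size(3))
    then show False
      using small i r by (simp add: word_pow_add)
  qed
  \<comment> \<open>A constant \<open>b\<close> would commute with \<open>g\<close>.\<close>
  moreover have "i > 0"
  proof (rule ccontr)
    assume "\<not> i > 0"
    then obtain d where "b = scalar d"
      using scalar_if_lw_Nil[of b] i by auto
    then show False
      using bg(1) by (simp add: commutator_def scalar_commute)
  qed
  ultimately show ?thesis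
    using that \<open>b \<noteq> 0\<close> i bg by blast
qed

text \<open>The descent is on \<open>j + q - k\<close>.  One of the coprime exponents \<open>Q\<close>, \<open>J\<close> that cancel the leading
  terms of \<open>a ^ Q\<close> and \<open>g ^ J\<close> is nonzero in the field, whatever its characteristic.\<close>

lemma lw_commutator_not_word_pow:
  fixes a g :: "('a, 'k::field) free_algebra"
  assumes "primitive_word t"
    and "a \<noteq> 0" "lw a = word_pow j t" "j > 0" and "g \<noteq> 0" "lw g = word_pow q t" "q > 0"
    and "commutator a g \<noteq> 0"
  shows "lw (commutator a g) \<noteq> word_pow k t"
  using assms(2-)
proof (induction "j + q - k" arbitrary: a g j q k rule: less_induct)
  case less
  show ?case
  proof
    assume k: "lw (commutator a g) = word_pow k t"
    have t0: "t \<noteq> []" using assms(1) by (simp add: primitive_word_def)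
    \<comment> \<open>The leading terms of \<open>a * g\<close> and \<open>g * a\<close> are equal
      and cancel. Hence the truncated difference \<open>j + q - k\<close> is positive and can drop
      properly.\<close>
    have kjq: "k < j + q"
    proof -
      have "leads (word_pow j t @ word_pow q t) (lc a * lc g) (a * g)"
        "leads (word_pow q t @ word_pow j t) (lc g * lc a) (g * a)"
        using leads_mult leads_lw less.prems by metis+
      then have "leads (word_pow (j + q) t) 0 (commutator a g)"
        unfolding commutator_def word_pow_add[symmetric]
        using leads_diff by (fastforce simp: add.commute mult.commute)
      then have *: "code (word_pow k t) < code (word_pow (j + q) t)"
        using leads_zeroE k less.prems(7) by metis
      then have "k * length t \<le> (j + q) * length t"
        using code_length by (metis length_word_pow)
      then have "k \<le> j + q" using t0 by simp
      moreover have "k \<noteq> j + q" using * by auto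
      ultimately show ?thesis by simp
    qed
    define d where "d = gcd j q"
    obtain Q J where QJ: "q = Q * d" "j = J * d" "coprime Q J"
      using gcd_coprime_exists[of q j] less.prems(3) unfolding d_def by (metis gcd.commute gcd_eq_0_iff less_irrefl)
    have pos: "Q > 0" "J > 0" using QJ less.prems by (auto intro: Nat.gr0I)
    have cross: "Q * j = J * q" using QJ by simp
    have "of_nat Q \<noteq> (0 :: 'k) \<or> of_nat J \<noteq> (0 :: 'k)"
    proof -
      \<comment> \<open>Bezout's identity with gcd 1, read in the field.\<close>
      obtain x y where "Q * x = J * y + gcd Q J"
        using bezout_nat[of Q J] pos by auto
      then have "of_nat Q * of_nat x = (of_nat J * of_nat y + 1 :: 'k)"
        using QJ(3) by (metis coprime_imp_gcd_eq_1 of_nat_1 of_nat_add of_nat_mult)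
      then show ?thesis by auto
    qed
    then show False
    proof
      assume nz: "of_nat Q \<noteq> (0 :: 'k)"
      obtain n where n: "Q = Suc n" using pos gr0_implies_Suc by blast
      obtain b i where b: "b \<noteq> 0" "lw b = word_pow i t" "0 < i" "i < Suc n * j"
        "commutator b g \<noteq> 0" "lw (commutator b g) = word_pow (n * j + k) t"
        by (rule commutator_descent[OF assms(1) less.prems(1,2,4-7) k, of n J])
          (use cross nz n in auto)
      have "i + q - (n * j + k) < j + q - k"
        using b(4) kjq by auto
      then show False
        using less.hyps[of i q "n * j + k" b g] b less.prems by auto
    next
      assume nz: "of_nat J \<noteq> (0 :: 'k)"
      obtain n where n: "J = Suc n" using pos gr0_implies_Suc by blast
      \<comment> \<open>The same descent with the roles of \<open>a\<close> and \<open>g\<close>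
        exchanged.\<close>
      have "commutator g a = - commutator a g" by (simp add: commutator_def)
      then have ga: "commutator g a \<noteq> 0" "lw (commutator g a) = word_pow k t"
        using less.prems(7) k by (auto simp: lw_def)
      obtain b i where b: "b \<noteq> 0" "lw b = word_pow i t" "0 < i" "i < Suc n * q"
        "commutator b a \<noteq> 0" "lw (commutator b a) = word_pow (n * q + k) t"
        by (rule commutator_descent[OF assms(1) less.prems(4,5,1,2,3) ga, of n Q])
          (use cross nz n in auto)
      have "i + j - (n * q + k) < j + q - k"
        using b(4) kjq by auto
      then show False
        using less.hyps[of i j "n * q + k" b a] b less.prems by auto
    qed
  qed
qed

text \<open>Gaussian elimination: for each leading word occurring in \<open>V\<close> choose one
  element \<open>b l\<close> with leading coefficient 1, and reduce \<open>e\<close> by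
  \<open>lc e\<close> times the element for \<open>lw e\<close>. The code of the leading word drops,
  so this stops; \<open>\<gamma> e\<close> collects the coordinates. The last two conclusions locate
  the top coordinate, which later shows that a particular cofactor is nonzero.\<close>

lemma leading_word_basis:
  fixes V :: "('a, 'k::field) free_algebra set"
  assumes V: "linear_subspace V"
  obtains b \<gamma> where
    "\<And>l. l \<in> lw ` (V - {0}) \<Longrightarrow> b l \<in> V \<and> b l \<noteq> 0 \<and> lw (b l) = l"
    "\<And>e. e \<in> V \<Longrightarrow> Poly_Mapping.keys (\<gamma> e) \<subseteq> lw ` (V - {0})"
    "\<And>e. e \<in> V \<Longrightarrow> e = (\<Sum>l\<in>Poly_Mapping.keys (\<gamma> e). scalar (Poly_Mapping.lookup (\<gamma> e) l) * b l)"
    "\<And>e l. e \<in> V \<Longrightarrow> l \<in> Poly_Mapping.keys (\<gamma> e) \<Longrightarrow> code l \<le> code (lw e)"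
    "\<And>e. e \<in> V \<Longrightarrow> e \<noteq> 0 \<Longrightarrow> Poly_Mapping.lookup (\<gamma> e) (lw e) = lc e"
proof -
  have "\<exists>b. b \<in> V \<and> b \<noteq> 0 \<and> lw b = l \<and> lc b = 1" if l: "l \<in> lw ` (V - {0})" for l
  proof -
    obtain e where e: "e \<in> V" "e \<noteq> 0" "lw e = l" using l by auto
    have "leads l (inverse (lc e) * lc e) (scalar (inverse (lc e)) * e)"
      using leads_scalar leads_lw e by metis
    then have "leads l 1 (scalar (inverse (lc e)) * e)"
      using lc_nonzero[OF e(2)] by simp
    then show ?thesis
      using leads_imp_lw[of l 1] V e(1) unfolding linear_subspace_def by (metis zero_neq_one)
  qed
  then obtain b where b: "\<And>l. l \<in> lw ` (V - {0}) \<Longrightarrow> b l \<in> V \<and> b l \<noteq> 0 \<and> lw (b l) = l \<and> lc (b l) = 1"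
    by metis
  define good where "good e c \<longleftrightarrow> Poly_Mapping.keys c \<subseteq> lw ` (V - {0}) \<and>
      e = (\<Sum>l\<in>Poly_Mapping.keys c. scalar (Poly_Mapping.lookup c l) * b l) \<and>
      (\<forall>l\<in>Poly_Mapping.keys c. code l \<le> code (lw e)) \<and>
      (e \<noteq> 0 \<longrightarrow> Poly_Mapping.lookup c (lw e) = lc e)" for e and c :: "'a list \<Rightarrow>\<^sub>0 'k"
  have "\<exists>c. good e c" if "e \<in> V" for e
    using that
  proof (induction "code (lw e)" arbitrary: e rule: less_induct)
    case less
    show ?case
    proof (cases "e = 0")
      case True
      have "good e 0" by (simp add: True good_def)
      then show ?thesis by blast
    next
      case False
      define w where "w = lw e"
      have w: "w \<in> lw ` (V - {0})" using less.prems False by (auto simp: w_def)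
      note bw = b[OF w]
      define e' where "e' = e + scalar (- lc e) * b w"
      have e'V: "e' \<in> V"
        using V less.prems bw unfolding e'_def linear_subspace_def by blast
      have "leads w 1 (b w)" using leads_lw[of "b w"] bw by auto
      then have "leads w (lc e + - lc e * 1) e'"
        unfolding e'_def using leads_lw[OF False] by (intro leads_add leads_scalar) (auto simp: w_def)
      then have e'0: "leads w 0 e'" by simp
      \<comment> \<open>The remainder 0 is treated apart: \<open>lw 0\<close> is arbitrary and need
        not lie below \<open>w\<close>.\<close>
      obtain c' where c': "good e' c'" and below: "\<And>l. l \<in> Poly_Mapping.keys c' \<Longrightarrow> code l < code w"
      proof (cases "e' = 0")
        case True
        then show ?thesis using that[of 0] by (auto simp: good_def)
      next
        case False
        then have "code (lw e') < code w" using leads_zeroE[OF e'0] by auto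
        then obtain c' where c': "good e' c'"
          using less.hyps[of e'] e'V by (auto simp: w_def)
        moreover have "code l < code w" if "l \<in> Poly_Mapping.keys c'" for l
          using c' that \<open>code (lw e') < code w\<close> unfolding good_def by fastforce
        ultimately show ?thesis by (rule that)
      qed
      define c where "c = c' + Poly_Mapping.single w (lc e)"
      have wc': "w \<notin> Poly_Mapping.keys c'" using below by blast
      have lookup_c: "Poly_Mapping.lookup c l = (if l = w then lc e else Poly_Mapping.lookup c' l)" for l
        using wc' by (auto simp: c_def lookup_add lookup_single in_keys_iff)
      have keys_c: "Poly_Mapping.keys c = insert w (Poly_Mapping.keys c')"
        using lc_nonzero[OF False] by (auto simp: in_keys_iff lookup_c split: if_splits)
      have "(\<Sum>l\<in>Poly_Mapping.keys c. scalar (Poly_Mapping.lookup c l) * b l)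
          = scalar (lc e) * b w + (\<Sum>l\<in>Poly_Mapping.keys c'. scalar (Poly_Mapping.lookup c l) * b l)"
        unfolding keys_c using wc' by (simp add: lookup_c)
      also have "(\<Sum>l\<in>Poly_Mapping.keys c'. scalar (Poly_Mapping.lookup c l) * b l)
          = (\<Sum>l\<in>Poly_Mapping.keys c'. scalar (Poly_Mapping.lookup c' l) * b l)"
        using wc' by (intro sum.cong) (auto simp: lookup_c)
      also have "\<dots> = e'" using c' by (simp add: good_def)
      also have "scalar (lc e) * b w + e' = e"
        by (simp add: e'_def scalar_simps)
      finally have "good e c"
        using c' w below by (auto simp: good_def keys_c lookup_c w_def intro: less_imp_le)
      then show ?thesis by blast
    qed
  qed
  then obtain \<gamma> where \<gamma>: "\<And>e. e \<in> V \<Longrightarrow> good e (\<gamma> e)"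
    by metis
  show ?thesis
  proof (rule that[of b \<gamma>])
    show "b l \<in> V \<and> b l \<noteq> 0 \<and> lw (b l) = l" if "l \<in> lw ` (V - {0})" for l
      using b[OF that] by simp
    show "Poly_Mapping.keys (\<gamma> e) \<subseteq> lw ` (V - {0})"
      "e = (\<Sum>l\<in>Poly_Mapping.keys (\<gamma> e). scalar (Poly_Mapping.lookup (\<gamma> e) l) * b l)"
      if "e \<in> V" for e
      using \<gamma>[OF that] unfolding good_def by simp_all
    show "code l \<le> code (lw e)" if "e \<in> V" "l \<in> Poly_Mapping.keys (\<gamma> e)" for e l
      using \<gamma>[OF that(1)] that(2) unfolding good_def by simp
    show "Poly_Mapping.lookup (\<gamma> e) (lw e) = lc e" if "e \<in> V" "e \<noteq> 0" for e
      using \<gamma>[OF that(1)] that(2) unfolding good_def by simp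
  qed
qed

end

section \<open>Weights of words in two letters\<close>

lemma weight_append [simp]: "weight a b (V @ W) = weight a b V + weight a b W"
  by (simp add: weight_def algebra_simps)

lemma weight_simps [simp]:
  "weight a b [] = 0" "weight a b (X # W) = a + weight a b W" "weight a b (Y # W) = b + weight a b W"
  by (simp_all add: weight_def)

lemma weight_replicate [simp]:
  "weight a b (replicate k X) = k * a" "weight a b (replicate k Y) = k * b"
  by (induction k) auto

text \<open>Tame words are the ones useless for the induction step, which needs a cut
  \<open>V @ Y # U\<close> whose suffix weighs at least \<open>a\<close>. In the application
  \<open>a\<close> and \<open>b\<close> are the degrees of \<open>f\<close> and
  \<open>g\<close>.\<close>

definition tame :: "nat \<Rightarrow> nat \<Rightarrow> xy list \<Rightarrow> bool" where
  "tame a b W \<longleftrightarrow> (\<forall>V U. W = V @ Y # U \<longrightarrow> weight a b U < a)"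

text \<open>An \<open>X\<close> standing after a \<open>Y\<close> would alone give the suffix weight
  \<open>a\<close>.\<close>

lemma tame_shape:
  assumes "tame a b W"
  shows "\<exists>i k. W = replicate i X @ replicate k Y \<and> (k = 0 \<or> (k - 1) * b < a)"
  using assms
proof (induction W)
  case (Cons l W)
  have "tame a b W"
    using Cons.prems unfolding tame_def by (metis append_Cons)
  then obtain i k where W: "W = replicate i X @ replicate k Y" "k = 0 \<or> (k - 1) * b < a"
    using Cons.IH by blast
  show ?case
  proof (cases l)
    case X
    then show ?thesis
      using W by (intro exI[of _ "Suc i"] exI[of _ k]) auto
  next
    case Y
    then have "weight a b W < a"
      using Cons.prems unfolding tame_def by blast
    then have "i * a + k * b < a" using W by simp
    then have "i = 0" "k * b < a" by (cases i; simp)+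
    then show ?thesis
      using W Y by (intro exI[of _ 0] exI[of _ "Suc k"]) auto
  qed
qed simp

text \<open>Two different shapes of equal weight give \<open>x * b = y * a\<close>, where
  \<open>x\<close> and \<open>y\<close> are the positive differences of the exponents.
  Nondivisibility excludes the value 1 for both, so the common value is at least
  \<open>2 * a\<close> and at least \<open>2 * b\<close>; but the bound on the number of trailing
  \<open>Y\<close> keeps it below \<open>a + b\<close>.\<close>

lemma tame_eqI:
  assumes "tame a b V" "tame a b W" "weight a b V = weight a b W" "\<not> a dvd b" "\<not> b dvd a"
  shows "V = W"
proof -
  obtain i k where V: "V = replicate i X @ replicate k Y" "k = 0 \<or> (k - 1) * b < a"
    using tame_shape[OF assms(1)] by blast
  obtain i' k' where W: "W = replicate i' X @ replicate k' Y" "k' = 0 \<or> (k' - 1) * b < a"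
    using tame_shape[OF assms(2)] by blast
  have ab: "a > 0" "b > 0" using assms(4,5) by (auto intro: Nat.gr0I)
  have False if e: "i * a + k * b = i' * a + k' * b" and lt: "k' < k" and small: "k = 0 \<or> (k - 1) * b < a"
    for i k i' k'
  proof -
    obtain x where k: "k = k' + x" and x: "x > 0"
      using lt less_imp_add_positive by metis
    have "i < i'"
    proof (rule ccontr)
      assume "\<not> i < i'"
      then have "i' * a \<le> i * a" by simp
      moreover have "k' * b < k * b" using lt ab by simp
      ultimately show False using e by linarith
    qed
    then obtain y where i': "i' = i + y" and y: "y > 0"
      using less_imp_add_positive by metis
    have xy: "x * b = y * a" using e k i' by (simp add: algebra_simps)
    have "x \<noteq> 1" "y \<noteq> 1" using xy assms(4,5) by (auto simp: dvd_def mult.commute)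
    then have "2 * b \<le> x * b" "2 * a \<le> y * a" using x y by auto
    moreover have "x * b \<le> k * b" using k by simp
    moreover have "k * b < a + b"
      using small lt by (cases k) auto
    ultimately show False using xy by linarith
  qed
  from this[of i k i' k'] this[of i' k' i k] have "k = k'"
    using V W assms(3) by (metis (no_types, lifting) linorder_neqE_nat weight_append weight_replicate)
  then show ?thesis
    using V W assms(3) ab by simp
qed

text \<open>By induction on the weight of \<open>U\<close>, at most one word of the form \<open>V @ Y # U\<close> contributes to each
  sum, because \<open>U\<close> is then tame and tame words are determined by their weight.\<close>

lemma nonzero_split_sum:
  fixes c :: "xy list \<Rightarrow> 'k::field"
  assumes T: "finite T" "\<And>W. W \<in> T \<Longrightarrow> weight a b W = w" "\<And>W. W \<in> T \<Longrightarrow> c W \<noteq> 0"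
    and W12: "W\<^sub>1 \<in> T" "W\<^sub>2 \<in> T" "W\<^sub>1 \<noteq> W\<^sub>2"
    and ndvd: "\<not> a dvd b" "\<not> b dvd a"
  shows "\<exists>V. weight a b V + b + a \<le> w \<and> (\<Sum>W | W \<in> T \<and> (\<exists>U. W = V @ Y # U). c W) \<noteq> 0"
proof (rule ccontr)
  assume "\<not> ?thesis"
  then have zero: "(\<Sum>W | W \<in> T \<and> (\<exists>U. W = V @ Y # U). c W) = 0" if "weight a b V + b + a \<le> w" for V
    using that by blast
  have "b > 0" using ndvd by (auto intro: Nat.gr0I)
  have claim: "V @ Y # U \<notin> T" if "a \<le> weight a b U" for U V
    using that
  proof (induction "weight a b U" arbitrary: U V rule: less_induct)
    case less
    show ?case
    proof
      assume VU: "V @ Y # U \<in> T"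
      have tame: "tame a b U'" if "V @ Y # U' \<in> T" for U'
        unfolding tame_def
      proof (intro allI impI)
        fix U1 U2 assume U': "U' = U1 @ Y # U2"
        have "weight a b U' = weight a b U"
          using T(2)[OF VU] T(2)[OF that] by simp
        then have "weight a b U2 < weight a b U"
          using U' \<open>b > 0\<close> by simp
        then show "weight a b U2 < a"
          using less.hyps[of U2 "V @ Y # U1"] that U' by fastforce
      qed
      have "{W. W \<in> T \<and> (\<exists>U. W = V @ Y # U)} = {V @ Y # U}"
      proof (intro equalityI subsetI)
        fix W assume "W \<in> {W. W \<in> T \<and> (\<exists>U. W = V @ Y # U)}"
        then obtain U' where W: "W = V @ Y # U'" "V @ Y # U' \<in> T" by auto
        then have "weight a b U' = weight a b U"
          using T(2)[OF VU] T(2)[OF W(2)] by simp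
        then have "U' = U"
          using tame_eqI[OF tame[OF W(2)] tame[OF VU] _ ndvd] by simp
        then show "W \<in> {V @ Y # U}" using W(1) by simp
      qed (use VU in auto)
      moreover have "weight a b V + b + a \<le> w"
        using T(2)[OF VU] less.prems by simp
      ultimately show False
        using zero[of V] T(3)[OF VU] by simp
    qed
  qed
  \<comment> \<open>By the claim every suffix after a \<open>Y\<close> is light, so all words of
    \<open>T\<close> are tame of the same weight and therefore equal.\<close>
  have "tame a b W" if "W \<in> T" for W
    using claim that unfolding tame_def by (metis not_less)
  then have "W\<^sub>1 = W\<^sub>2"
    using tame_eqI[OF _ _ _ ndvd] W12 T(2) by metis
  then show False using W12 by simp
qed

section \<open>Expanding the commutator of h with P(f, g)\<close>

text \<open>This is R_l in the expansion of [h, P(f, g)] as the sum of R_l(f, g) [h, g] b_l. A cut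
  of a word of \<open>P\<close> into \<open>V @ Y # U\<close> contributes the prefix
  \<open>V\<close>, weighted with the coordinate at \<open>l\<close> of the value of
  \<open>U\<close>.\<close>

definition cofactor :: "(xy, 'k::field) free_algebra \<Rightarrow> (xy list \<Rightarrow> ('a, 'k) free_algebra) \<Rightarrow> 'a list \<Rightarrow> (xy, 'k) free_algebra" where
  "cofactor P \<gamma> l = (\<Sum>W\<in>Poly_Mapping.keys P. \<Sum>i<length W. if W ! i = Y then
     Poly_Mapping.single (take i W) (Poly_Mapping.lookup P W * Poly_Mapping.lookup (\<gamma> (drop (Suc i) W)) l) else 0)"

text \<open>Apply the Leibniz rule to each word of \<open>P\<close>, expand the factor right of
  \<open>commutator h g\<close> in the elements \<open>b l\<close>, and collect the left factors by
  \<open>l\<close>; scalars are central.\<close>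

lemma commutator_cofactor_expansion:
  assumes "commutator h f = 0" "finite \<Lambda>"
    and \<gamma>: "\<And>V U. V @ Y # U \<in> Poly_Mapping.keys P \<Longrightarrow> Poly_Mapping.keys (\<gamma> U) \<subseteq> \<Lambda>"
      "\<And>V U. V @ Y # U \<in> Poly_Mapping.keys P \<Longrightarrow> word_val f g U =
          (\<Sum>l\<in>Poly_Mapping.keys (\<gamma> U). scalar (Poly_Mapping.lookup (\<gamma> U) l) * b l)"
  shows "commutator h (subst_xy f g P) = (\<Sum>l\<in>\<Lambda>. subst_xy f g (cofactor P \<gamma> l) * commutator h g * b l)"
proof -
  let ?c = "\<lambda>W i. if W ! i = Y then word_val f g (take i W) * commutator h g * word_val f g (drop (Suc i) W) else 0"
  let ?d = "\<lambda>W i l. if W ! i = Y then scalar (Poly_Mapping.lookup P W * Poly_Mapping.lookup (\<gamma> (drop (Suc i) W)) l)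
      * word_val f g (take i W) else 0"
  have term_eq: "scalar (Poly_Mapping.lookup P W) * ?c W i = (\<Sum>l\<in>\<Lambda>. ?d W i l * commutator h g * b l)"
    if W: "W \<in> Poly_Mapping.keys P" "i < length W" for W i
  proof (cases "W ! i = Y")
    case True
    define U where "U = drop (Suc i) W"
    have "W = take i W @ Y # U"
      using W(2) True by (metis U_def id_take_nth_drop)
    then have U: "Poly_Mapping.keys (\<gamma> U) \<subseteq> \<Lambda>" "word_val f g U =
          (\<Sum>l\<in>Poly_Mapping.keys (\<gamma> U). scalar (Poly_Mapping.lookup (\<gamma> U) l) * b l)"
      using \<gamma> W(1) by metis+
    have "word_val f g U = (\<Sum>l\<in>\<Lambda>. scalar (Poly_Mapping.lookup (\<gamma> U) l) * b l)"
      unfolding U(2) using U(1) assms(2)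
      by (intro sum.mono_neutral_left) (auto simp: in_keys_iff scalar_simps)
    moreover have "scalar (c * d) * a * h * b = scalar c * (a * h * (scalar d * b))"
      for c d and a h b :: "('a, 'b) free_algebra"
      unfolding scalar_left_commute[of "a * h" d b] scalar_simps by (simp only: mult.assoc)
    ultimately show ?thesis
      using True by (simp only: simp_thms if_True sum_distrib_left flip: U_def)
  qed simp
  have "commutator h (subst_xy f g P) = (\<Sum>W\<in>Poly_Mapping.keys P. \<Sum>i<length W. scalar (Poly_Mapping.lookup P W) * ?c W i)"
    unfolding subst_xy_def commutator_sum commutator_scalar_mult commutator_word_val[OF assms(1)]
    by (simp only: sum_distrib_left)
  also have "\<dots> = (\<Sum>W\<in>Poly_Mapping.keys P. \<Sum>i<length W. \<Sum>l\<in>\<Lambda>. ?d W i l * commutator h g * b l)"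
    by (intro sum.cong refl term_eq) auto
  also have "\<dots> = (\<Sum>W\<in>Poly_Mapping.keys P. \<Sum>l\<in>\<Lambda>. \<Sum>i<length W. ?d W i l * commutator h g * b l)"
    by (intro sum.cong refl sum.swap)
  also have "\<dots> = (\<Sum>l\<in>\<Lambda>. \<Sum>W\<in>Poly_Mapping.keys P. \<Sum>i<length W. ?d W i l * commutator h g * b l)"
    by (rule sum.swap)
  also have "\<dots> = (\<Sum>l\<in>\<Lambda>. (\<Sum>W\<in>Poly_Mapping.keys P. \<Sum>i<length W. ?d W i l) * commutator h g * b l)"
    by (simp only: sum_distrib_right)
  also have "\<dots> = (\<Sum>l\<in>\<Lambda>. subst_xy f g (cofactor P \<gamma> l) * commutator h g * b l)"
    unfolding cofactor_def subst_xy_sum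
    by (intro sum.cong refl arg_cong2[where f = times]) (auto simp: subst_xy_single)
  finally show ?thesis .
qed

text \<open>The prefix \<open>V\<close> arises only from the cut at position
  \<open>length V\<close>.\<close>

lemma lookup_cofactor:
  "Poly_Mapping.lookup (cofactor P \<gamma> l) V = (\<Sum>W | W \<in> Poly_Mapping.keys P \<and> (\<exists>U. W = V @ Y # U).
     Poly_Mapping.lookup P W * Poly_Mapping.lookup (\<gamma> (drop (Suc (length V)) W)) l)"
proof -
  let ?x = "\<lambda>W i. Poly_Mapping.lookup P W * Poly_Mapping.lookup (\<gamma> (drop (Suc i) W)) l"
  have inner: "(\<Sum>i<length W. Poly_Mapping.lookup (if W ! i = Y then Poly_Mapping.single (take i W) (?x W i) else 0) V)
      = (if \<exists>U. W = V @ Y # U then ?x W (length V) else 0)" for W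
  proof -
    have "(\<Sum>i<length W. Poly_Mapping.lookup (if W ! i = Y then Poly_Mapping.single (take i W) (?x W i) else 0) V)
      = (\<Sum>i<length W. if i = length V then (if \<exists>U. W = V @ Y # U then ?x W (length V) else 0) else 0)"
    proof (intro sum.cong refl)
      fix i assume i: "i \<in> {..<length W}"
      have "W ! i = Y \<and> take i W = V \<longleftrightarrow> i = length V \<and> (\<exists>U. W = V @ Y # U)"
      proof
        assume a: "W ! i = Y \<and> take i W = V"
        then have "W = V @ Y # drop (Suc i) W"
          using i id_take_nth_drop[of i W] by auto
        then show "i = length V \<and> (\<exists>U. W = V @ Y # U)"
          using a i by auto
      qed auto
      then show "Poly_Mapping.lookup (if W ! i = Y then Poly_Mapping.single (take i W) (?x W i) else 0) V
        = (if i = length V then (if \<exists>U. W = V @ Y # U then ?x W (length V) else 0) else 0)"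
        by (auto simp: lookup_single when_def)
    qed
    then show ?thesis by auto
  qed
  have "Poly_Mapping.lookup (cofactor P \<gamma> l) V
      = (\<Sum>W\<in>Poly_Mapping.keys P. if \<exists>U. W = V @ Y # U then ?x W (length V) else 0)"
    unfolding cofactor_def lookup_sum inner ..
  also have "\<dots> = (\<Sum>W | W \<in> Poly_Mapping.keys P \<and> (\<exists>U. W = V @ Y # U). ?x W (length V))"
    by (rule sum.inter_filter[symmetric]) simp
  finally show ?thesis .
qed

text \<open>Cofactors consist of proper prefixes; this feeds the induction on word length.\<close>

lemma keys_cofactor:
  assumes "V \<in> Poly_Mapping.keys (cofactor P \<gamma> l)"
  shows "\<exists>W\<in>Poly_Mapping.keys P. length V < length W"
proof (rule ccontr)
  assume "\<not> ?thesis"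
  then have "{W. W \<in> Poly_Mapping.keys P \<and> (\<exists>U. W = V @ Y # U)} = {}" by auto
  then have "Poly_Mapping.lookup (cofactor P \<gamma> l) V = 0"
    unfolding lookup_cofactor by (simp only: sum.empty)
  then show False using assms by (simp add: in_keys_iff)
qed

context word_order
begin

lemma leads_word_val:
  assumes "f \<noteq> 0" "g \<noteq> 0"
  shows "leads (xy_word (lw f) (lw g) W) (lc f ^ count_list W X * lc g ^ count_list W Y) (word_val f g W)"
proof (induction W)
  case Nil
  then show ?case by (simp add: leads_def lookup_one zero_list_def)
next
  case (Cons a W)
  show ?case
    using leads_mult[OF leads_lw[OF assms(1)] Cons.IH] leads_mult[OF leads_lw[OF assms(2)] Cons.IH]
    by (cases a) (simp_all add: ac_simps)
qed

lemma lw_word_val: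
  assumes "f \<noteq> 0" "g \<noteq> 0"
  shows "word_val f g W \<noteq> 0" "lw (word_val f g W) = xy_word (lw f) (lw g) W"
    "lc (word_val f g W) = lc f ^ count_list W X * lc g ^ count_list W Y"
    "deg (word_val f g W) = weight (deg f) (deg g) W"
proof -
  have "lc f ^ count_list W X * lc g ^ count_list W Y \<noteq> 0"
    using lc_nonzero assms by auto
  note * = leads_imp_lw[OF leads_word_val[OF assms] this]
  show "word_val f g W \<noteq> 0" "lw (word_val f g W) = xy_word (lw f) (lw g) W"
    "lc (word_val f g W) = lc f ^ count_list W X * lc g ^ count_list W Y"
    by (fact *)+
  then show "deg (word_val f g W) = weight (deg f) (deg g) W"
    by (simp add: deg_lw assms length_xy_word)
qed

end

section \<open>The degree bound when the leading words commute\<close>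

lemma weight_le_weighted_deg: "W \<in> Poly_Mapping.keys P \<Longrightarrow> weight a b W \<le> weighted_deg a b P"
  by (auto simp: weighted_deg_def)

lemma weighted_deg_attained:
  assumes "P \<noteq> 0"
  shows "\<exists>W\<in>Poly_Mapping.keys P. weight a b W = weighted_deg a b P"
proof -
  have "Max (weight a b ` Poly_Mapping.keys P) \<in> weight a b ` Poly_Mapping.keys P"
    using assms by (intro Max_in) auto
  then obtain W where "W \<in> Poly_Mapping.keys P" "Max (weight a b ` Poly_Mapping.keys P) = weight a b W"
    by blast
  then show ?thesis using assms by (auto simp: weighted_deg_def intro!: bexI[of _ W])
qed

text \<open>\<open>L\<close> reads a word as a numeral, so it compares words of equal length lexicographically from the
  left.  It need not be related to \<open>code\<close>: words are compared by \<open>code\<close> to find leading words and by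
  \<open>L\<close> to tell apart products of leading words.\<close>

locale commuting_leads = word_order code for code :: "'a list \<Rightarrow> nat" +
  fixes f g :: "('a, 'k::field) free_algebra" and t :: "'a list" and p q :: nat
    and L :: "'a list \<Rightarrow> nat" and K :: nat
  assumes t: "primitive_word t"
    and f: "f \<noteq> 0" "lw f = word_pow p t" "p > 0"
    and g: "g \<noteq> 0" "lw g = word_pow q t" "q > 0"
    and comm: "commutator f g \<noteq> 0"
    and code_comm: "code (lw (commutator f g) @ t) < code (t @ lw (commutator f g))"
    and L_append: "L (u @ v) = L u * K ^ length v + L v"
    and L_bound: "L v < K ^ length v"
    and L_comm: "L (lw (commutator f g) @ t) < L (t @ lw (commutator f g))"
    and ndvd: "\<not> deg f dvd deg g" "\<not> deg g dvd deg f"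
begin

abbreviation \<sigma> :: "'a list" where
  "\<sigma> \<equiv> lw (commutator f g)"

text \<open>The inequality is weak so that powers of \<open>t\<close> are included. For \<sigma> it
  is strict, and \<open>no_collision\<close> rests on this contrast.\<close>

definition good :: "'a list \<Rightarrow> bool" where
  "good w \<longleftrightarrow> L (w @ t) \<le> L (t @ w)"

section \<open>Comparing words with powers of t through L\<close>

lemma K_pos: "0 < K ^ n"
proof -
  have "K > 0" using L_bound[of t] t by (cases "K = 0"; cases t) (auto simp: primitive_word_def)
  then show ?thesis by simp
qed

lemma L_append_left_iff: "L (w @ u) \<le> L (w @ v) \<longleftrightarrow> L u \<le> L v" if "length u = length v"
  using that by (simp add: L_append)

lemma L_append_right_iff: "L (u @ w) \<le> L (v @ w) \<longleftrightarrow> L u \<le> L v"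
  using K_pos[of "length w"] by (simp add: L_append del: nat_zero_less_power_iff)

lemma L_less_append:
  assumes "L u < L v" "length x = length y"
  shows "L (u @ x) < L (v @ y)"
proof -
  have "L (u @ x) < Suc (L u) * K ^ length y"
    using L_bound[of x] assms(2) by (simp add: L_append)
  also have "\<dots> \<le> L v * K ^ length y"
    using assms(1) by (intro mult_le_mono1) simp
  finally show ?thesis by (simp add: L_append)
qed

text \<open>Move \<open>t\<close> leftwards past \<open>v\<close> and then past \<open>u\<close>.
  Thus good words form a monoid.\<close>

lemma good_append:
  assumes "good u" "good v"
  shows "good (u @ v)"
proof -
  have "L (u @ v @ t) \<le> L (u @ t @ v)"
    using assms(2) by (subst L_append_left_iff) (auto simp: good_def)
  also have "L (u @ t @ v) = L ((u @ t) @ v)"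
    by simp
  also have "L ((u @ t) @ v) \<le> L ((t @ u) @ v)"
    using assms(1) by (subst L_append_right_iff) (auto simp: good_def)
  finally show ?thesis by (simp add: good_def)
qed

lemma good_if_commute: "w @ t = t @ w \<Longrightarrow> good w"
  by (simp add: good_def)

lemma word_pow_commute_t: "word_pow n t @ t = t @ word_pow n t"
  using word_pow_commute[of n t 1] by simp

lemma good_word_pow: "good (word_pow n t)"
  by (simp add: good_if_commute word_pow_commute_t)

lemma good_cancel_left: "good (word_pow n t @ w) \<Longrightarrow> good w"
proof -
  assume "good (word_pow n t @ w)"
  then have "L (word_pow n t @ w @ t) \<le> L (word_pow n t @ t @ w)"
    unfolding good_def by (metis append.assoc word_pow_commute_t)
  then show ?thesis
    by (subst (asm) L_append_left_iff) (auto simp: good_def)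
qed

lemma good_cancel_right: "good (w @ word_pow n t) \<Longrightarrow> good w"
proof -
  assume "good (w @ word_pow n t)"
  then have "L ((w @ t) @ word_pow n t) \<le> L ((t @ w) @ word_pow n t)"
    unfolding good_def by (metis append.assoc word_pow_commute_t)
  then show ?thesis
    by (subst (asm) L_append_right_iff) (auto simp: good_def)
qed

lemma good_L_le: "good w \<Longrightarrow> L (w @ word_pow n t) \<le> L (word_pow n t @ w)"
proof (induction n)
  case (Suc n)
  have "L ((w @ t) @ word_pow n t) \<le> L ((t @ w) @ word_pow n t)"
    using Suc.prems by (subst L_append_right_iff) (auto simp: good_def)
  also have "L ((t @ w) @ word_pow n t) = L (t @ w @ word_pow n t)"
    by simp
  also have "L (t @ w @ word_pow n t) \<le> L (t @ word_pow n t @ w)"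
    using Suc by (subst L_append_left_iff) auto
  finally show ?case by simp
qed simp

lemma good_sigma: "good \<sigma>"
  using L_comm by (simp add: good_def)

lemma L_sigma_less: "n > 0 \<Longrightarrow> L (\<sigma> @ word_pow n t) < L (word_pow n t @ \<sigma>)"
proof (cases n)
  case (Suc k)
  have "L ((\<sigma> @ t) @ word_pow k t) < L ((t @ \<sigma>) @ word_pow k t)"
    using L_comm by (rule L_less_append) simp
  also have "L ((t @ \<sigma>) @ word_pow k t) = L (t @ \<sigma> @ word_pow k t)"
    by simp
  also have "L (t @ \<sigma> @ word_pow k t) \<le> L (t @ word_pow k t @ \<sigma>)"
    using good_L_le[OF good_sigma] by (subst L_append_left_iff) auto
  finally show ?thesis using Suc by simp
qed simp

lemma code_sigma_word_pow: "n > 0 \<Longrightarrow> code (\<sigma> @ word_pow n t) < code (word_pow n t @ \<sigma>)"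
  using code_word_pow_less code_comm by blast

text \<open>Let \<open>u = x @ v\<close> be the longer right factor. The two copies of the central
  word are shifted against each other by a word \<open>z\<close> as long as \<open>x\<close>. Being
  short compared with the block of \<open>t\<close>, it is some \<open>word_pow n t\<close>. If
  \<open>n > 0\<close>, cancelling the block leaves
  \<open>\<sigma> @ x = word_pow n t @ \<sigma>\<close>; the strict inequality for \<sigma> makes
  \<open>x\<close> exceed \<open>word_pow n t\<close> under \<open>L\<close>, so \<open>u\<close> is
  not good.\<close>

lemma no_collision:
  assumes eq: "r @ (word_pow a t @ \<sigma>) @ u = s @ (word_pow a t @ \<sigma>) @ v"
    and good: "good u" "good v"
    and len: "length u + length t \<le> length (word_pow a t)" "length v + length t \<le> length (word_pow a t)"
  shows "u = v"
proof -
  have main: "u = v"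
    if eq: "r @ (word_pow a t @ \<sigma>) @ u = s @ (word_pow a t @ \<sigma>) @ v"
      and "good u" and lu: "length u + length t \<le> length (word_pow a t)" and uv: "length v \<le> length u"
    for u v r s
  proof -
    let ?w = "word_pow a t @ \<sigma>"
    have "t \<noteq> []" using t by (simp add: primitive_word_def)
    then obtain a' where a: "a = Suc a'" using lu by (cases a) auto
    define x where "x = take (length u - length v) u"
    have ux: "u = x @ v"
    proof -
      have "drop (length (r @ ?w @ u) - length v) (r @ ?w @ u) = v"
        unfolding eq by simp
      then have "drop (length u - length v) u = v"
        using uv by simp
      then show ?thesis unfolding x_def by (metis append_take_drop_id)
    qed
    have eq': "r @ ?w @ x = s @ ?w"
      using eq ux by simp
    define z where "z = drop (length r) s"
    have "length s = length r + length x"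
      using arg_cong[OF eq', of length] by simp
    then have sz: "s = r @ z"
      using eq' by (metis append_eq_append_conv_if append_take_drop_id le_add1 z_def)
    then have zw: "?w @ x = z @ ?w"
      using eq' by simp
    have lz: "length z = length x"
      using arg_cong[OF zw, of length] by simp
    have lx: "length x + length t \<le> length (word_pow a t)"
      using lu ux by simp
    have a1: "word_pow a t = t @ word_pow a' t" by (simp add: a)
    have a2: "word_pow a t = word_pow a' t @ t" using a1 word_pow_commute_t by simp
    \<comment> \<open>Read the first \<open>length z + length t\<close> letters of
      \<open>z @ ?w = ?w @ x\<close> in both ways; on the right they lie inside
      \<open>word_pow a t\<close> by the length bound.\<close>
    have "z @ t = take (length z + length t) (z @ ?w)"
      by (simp add: a1)
    also have "\<dots> = take (length z + length t) (word_pow a t)"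
      using lx lz by (simp flip: zw)
    also have "\<dots> = take (length z + length t) (t @ word_pow a' t)"
      by (simp only: a1)
    also have "\<dots> = t @ take (length z) (word_pow a' t)"
      by simp
    also have "take (length z) (word_pow a' t) = take (length z) (word_pow a t)"
      using lx lz unfolding a2 by (simp add: a)
    also have "take (length z) (word_pow a t) = take (length z) (z @ ?w)"
      using lx lz by (simp flip: zw)
    finally have "z @ t = t @ z" by simp
    then obtain n where n: "z = word_pow n t"
      using t primitive_wordD by metis
    have "n = 0"
    proof (rule ccontr)
      assume "n \<noteq> 0"
      have "word_pow a t @ \<sigma> @ x = word_pow a t @ word_pow n t @ \<sigma>"
        using zw n word_pow_commute[of n t a] by (metis append.assoc)
      then have "\<sigma> @ x = word_pow n t @ \<sigma>" by simp
      then have "L (\<sigma> @ word_pow n t) < L (\<sigma> @ x)"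
        using L_sigma_less[of n] \<open>n \<noteq> 0\<close> by simp
      then have "L (word_pow n t) < L x"
        using L_append_left_iff[of x "word_pow n t" \<sigma>] lz n by (simp add: not_le[symmetric])
      then have "L (word_pow n t @ x @ v) < L (x @ v @ word_pow n t)"
        by (rule L_less_append) (use lz n in simp)
      then show False
        using good_L_le[OF \<open>good u\<close>, of n] ux by simp
    qed
    then show ?thesis using n lz ux by simp
  qed
  show ?thesis
  proof (cases "length v \<le> length u")
    case True
    then show ?thesis using main eq good len by blast
  next
    case False
    then show ?thesis using main[of s v r u] eq good len by simp
  qed
qed

text \<open>By \<open>code_comm\<close> a power of \<open>t\<close> is worth more to the left of
  \<sigma> than to its right, so a single Leibniz term dominates. Unlike in
  \<open>leads_commutator_power\<close>, no integer factor arises that could vanish in the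
  field.\<close>

lemma lw_commutator_power:
  "commutator (f ^ Suc n) g \<noteq> 0 \<and> lw (commutator (f ^ Suc n) g) = word_pow (n * p) t @ \<sigma>"
proof (induction n)
  case 0
  then show ?case using comm by simp
next
  case (Suc n)
  have *: "commutator (f ^ Suc (Suc n)) g = f * commutator (f ^ Suc n) g + commutator f g * f ^ Suc n"
    by (simp add: commutator_def algebra_simps)
  define c where "c = lc f * lc (commutator (f ^ Suc n) g)"
  have "c \<noteq> 0"
    unfolding c_def using lc_nonzero[OF f(1)] lc_nonzero[OF conjunct1[OF Suc.IH]] by (metis mult_eq_0_iff)
  have "leads (word_pow p t @ word_pow (n * p) t @ \<sigma>) c (f * commutator (f ^ Suc n) g)"
    using leads_mult[OF leads_lw[OF f(1)] leads_lw] Suc.IH f(2) by (metis c_def)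
  then have "leads (word_pow (Suc n * p) t @ \<sigma>) c (f * commutator (f ^ Suc n) g)"
    by (simp add: word_pow_add)
  moreover have "leads (\<sigma> @ word_pow (Suc n * p) t) (lc (commutator f g) * lc f ^ Suc n) (commutator f g * f ^ Suc n)"
    using leads_mult[OF leads_lw[OF comm] leads_power[OF leads_lw[OF f(1)], of "Suc n"]]
    by (simp only: f(2) word_pow_mult)
  then have "leads (word_pow (Suc n * p) t @ \<sigma>) 0 (commutator f g * f ^ Suc n)"
    by (rule leads_lower) (intro code_sigma_word_pow, use f(3) in simp)
  ultimately have "leads (word_pow (Suc n * p) t @ \<sigma>) (c + 0) (commutator (f ^ Suc (Suc n)) g)"
    unfolding * by (rule leads_add)
  then show ?case
    using leads_imp_lw \<open>c \<noteq> 0\<close> by fastforce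
qed

section \<open>Values of polynomials and the induction on word length\<close>

lemma deg_f: "deg f = p * length t"
  by (simp add: deg_lw f)

text \<open>The space in which the values of suffixes are expanded; the induction hypothesis of
  \<open>degree_bound\<close> covers its nonzero elements.\<close>

definition short_values :: "nat \<Rightarrow> ('a, 'k) free_algebra set" where
  "short_values B = {subst_xy f g P | P. \<forall>W\<in>Poly_Mapping.keys P. length W < B}"

lemma linear_subspace_short_values: "linear_subspace (short_values B)"
  unfolding linear_subspace_def
proof (intro conjI ballI allI)
  show "0 \<in> short_values B"
    unfolding short_values_def by (auto intro: exI[of _ 0])
  fix x assume "x \<in> short_values B"
  then obtain P where P: "x = subst_xy f g P" "\<forall>W\<in>Poly_Mapping.keys P. length W < B"
    by (auto simp: short_values_def)
  show "scalar c * x \<in> short_values B" for c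
    unfolding short_values_def P(1) subst_xy_scalar_mult[symmetric]
    using P(2) by (force simp: in_keys_iff)
  fix y assume "y \<in> short_values B"
  then obtain Q where Q: "y = subst_xy f g Q" "\<forall>W\<in>Poly_Mapping.keys Q. length W < B"
    by (auto simp: short_values_def)
  show "x + y \<in> short_values B"
    unfolding short_values_def P(1) Q(1) subst_xy_add[symmetric]
    using P(2) Q(2) Poly_Mapping.keys_add[of P Q] by blast
qed

lemma word_val_short: "length W < B \<Longrightarrow> word_val f g W \<in> short_values B"
proof -
  assume "length W < B"
  then have "subst_xy f g (Poly_Mapping.single W 1) \<in> short_values B"
    unfolding short_values_def by auto
  then show ?thesis by (simp add: subst_xy_single scalar_simps)
qed

text \<open>Values of words of smaller weight have shorter leading words and cannot cancel the top
  one.\<close>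

lemma degree_bound_if_unique_top_word:
  assumes "W\<^sub>0 \<in> Poly_Mapping.keys P" 
    and "\<And>W. W \<in> Poly_Mapping.keys P \<Longrightarrow> W \<noteq> W\<^sub>0 \<Longrightarrow> weight (deg f) (deg g) W < weight (deg f) (deg g) W\<^sub>0"
  shows "subst_xy f g P \<noteq> 0 \<and> deg (subst_xy f g P) = weight (deg f) (deg g) W\<^sub>0"
proof -
  let ?w = "lw (word_val f g W\<^sub>0)"
  let ?c = "Poly_Mapping.lookup P W\<^sub>0 * lc (word_val f g W\<^sub>0)"
  have "leads ?w (if W = W\<^sub>0 then ?c else 0) (scalar (Poly_Mapping.lookup P W) * word_val f g W)"
    if W: "W \<in> Poly_Mapping.keys P" for W
  proof (cases "W = W\<^sub>0")
    case True
    then show ?thesis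
      using leads_scalar[OF leads_lw[OF lw_word_val(1)[OF f(1) g(1)]]] by simp
  next
    case False
    then have "length (lw (word_val f g W)) < length ?w"
      using assms(2)[OF W] lw_word_val(1,4)[OF f(1) g(1)] deg_lw by metis
    then have "leads ?w 0 (word_val f g W)"
      by (intro leads_zero_if_lw_less code_less_if_length)
    from leads_scalar[OF this] show ?thesis using False by simp
  qed
  then have "leads ?w (\<Sum>W\<in>Poly_Mapping.keys P. if W = W\<^sub>0 then ?c else 0) (subst_xy f g P)"
    unfolding subst_xy_def by (rule leads_sum)
  then have "leads ?w ?c (subst_xy f g P)"
    using assms(1) by simp
  moreover have "?c \<noteq> 0"
    using assms(1) lc_nonzero[OF lw_word_val(1)[OF f(1) g(1)]] by (auto simp: in_keys_iff)
  ultimately show ?thesis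
    using leads_imp_lw deg_lw lw_word_val(1,4)[OF f(1) g(1)] by metis
qed

text \<open>Induction on the strict bound \<open>B\<close> for the word lengths, with the
  denominator of the estimate cleared. Nonvanishing and goodness are carried along because the step
  uses both for the cofactors, and goodness also for the basis words \<open>l\<close>.\<close>

lemma degree_bound:
  assumes "\<forall>W\<in>Poly_Mapping.keys P. length W < B" "P \<noteq> 0"
  shows "subst_xy f g P \<noteq> 0 \<and> good (lw (subst_xy f g P)) \<and>
    deg (commutator f g) * weighted_deg (deg f) (deg g) P \<le> (deg f + deg g) * deg (subst_xy f g P)"
  using assms
proof (induction B arbitrary: P)
  case 0
  then show ?case by auto
next
  case (Suc B)
  let ?m = "deg f" and ?n = "deg g" and ?E = "subst_xy f g"
  let ?wt = "weight ?m ?n"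
  note IH = Suc.IH
  have short: "length W \<le> B" if "W \<in> Poly_Mapping.keys P" for W
    using Suc.prems(1) that by force
  \<comment> \<open>Words of \<open>P\<close> have length at most \<open>B\<close>, so the prefix
    before a \<open>Y\<close> and the suffix after it are both shorter than \<open>B\<close> and
    fall under the induction hypothesis.\<close>
  define V where "V = short_values B"
  obtain b \<gamma>' where b: "\<And>l. l \<in> lw ` (V - {0}) \<Longrightarrow> b l \<in> V \<and> b l \<noteq> 0 \<and> lw (b l) = l"
    and \<gamma>'1: "\<And>e. e \<in> V \<Longrightarrow> Poly_Mapping.keys (\<gamma>' e) \<subseteq> lw ` (V - {0})"
    and \<gamma>'2: "\<And>e. e \<in> V \<Longrightarrow> e = (\<Sum>l\<in>Poly_Mapping.keys (\<gamma>' e). scalar (Poly_Mapping.lookup (\<gamma>' e) l) * b l)"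
    and \<gamma>'3: "\<And>e l. e \<in> V \<Longrightarrow> l \<in> Poly_Mapping.keys (\<gamma>' e) \<Longrightarrow> code l \<le> code (lw e)"
    and \<gamma>'4: "\<And>e. e \<in> V \<Longrightarrow> e \<noteq> 0 \<Longrightarrow> Poly_Mapping.lookup (\<gamma>' e) (lw e) = lc e"
    using leading_word_basis[OF linear_subspace_short_values, of B thesis] unfolding V_def by blast
  define \<gamma> where "\<gamma> U = \<gamma>' (word_val f g U)" for U
  define S where "S = {U. \<exists>V. V @ Y # U \<in> Poly_Mapping.keys P}"
  define \<Lambda> where "\<Lambda> = (\<Union>U\<in>S. Poly_Mapping.keys (\<gamma> U))"
  have "finite S"
  proof (rule finite_subset)
    show "S \<subseteq> (\<Union>W\<in>Poly_Mapping.keys P. (\<lambda>i. drop i W) ` {..length W})"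
    proof
      fix U assume "U \<in> S"
      then obtain V where V: "V @ Y # U \<in> Poly_Mapping.keys P" by (auto simp: S_def)
      have "U = drop (Suc (length V)) (V @ Y # U)" by simp
      then show "U \<in> (\<Union>W\<in>Poly_Mapping.keys P. (\<lambda>i. drop i W) ` {..length W})"
        using V by (intro UN_I[OF V] image_eqI[where x = "Suc (length V)"]) auto
    qed
  qed auto
  then have "finite \<Lambda>" by (auto simp: \<Lambda>_def)
  have SV: "word_val f g U \<in> V" if "U \<in> S" for U
    using that short unfolding S_def V_def by (force intro: word_val_short)
  have \<Lambda>V: "l \<in> lw ` (V - {0})" if "l \<in> \<Lambda>" for l
    using that \<gamma>'1 SV unfolding \<Lambda>_def \<gamma>_def by blast
  have bl: "b l \<noteq> 0" "lw (b l) = l" "good l" if "l \<in> \<Lambda>" for l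
  proof -
    have *: "b l \<in> V" "b l \<noteq> 0" "lw (b l) = l" using b[OF \<Lambda>V[OF that]] by auto
    then obtain Q where Q: "b l = ?E Q" "\<forall>W\<in>Poly_Mapping.keys Q. length W < B"
      by (auto simp: V_def short_values_def)
    then have "Q \<noteq> 0" using * by auto
    with IH[OF Q(2)] * Q(1) show "b l \<noteq> 0" "lw (b l) = l" "good l" by auto
  qed
  define R where "R = cofactor P \<gamma>"
  have R: "?E (R l) \<noteq> 0" "good (lw (?E (R l)))"
    "deg (commutator f g) * weighted_deg ?m ?n (R l) \<le> (?m + ?n) * deg (?E (R l))"
    if "R l \<noteq> 0" for l
  proof -
    have "\<forall>W\<in>Poly_Mapping.keys (R l). length W < B"
      using keys_cofactor short unfolding R_def by (metis order_less_le_trans)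
    from IH[OF this that] show "?E (R l) \<noteq> 0" "good (lw (?E (R l)))"
      "deg (commutator f g) * weighted_deg ?m ?n (R l) \<le> (?m + ?n) * deg (?E (R l))"
      by auto
  qed
  \<comment> \<open>Large enough that the block \<open>word_pow (N * p) t\<close> meets the length
    condition of \<open>no_collision\<close>; the summand 1 makes room for the extra
    \<open>t\<close>.\<close>
  define N where "N = (\<Sum>l\<in>\<Lambda>. length l) + 1"
  have N: "length l + length t \<le> length (word_pow (N * p) t)" if "l \<in> \<Lambda>" for l
  proof -
    have "length l \<le> (\<Sum>l\<in>\<Lambda>. length l)"
      using \<open>finite \<Lambda>\<close> that by (intro member_le_sum) auto
    moreover have "length t \<ge> 1" using t by (cases t) (auto simp: primitive_word_def)
    ultimately have "length l + length t \<le> N * length t"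
      unfolding N_def by (simp add: add_mono order_trans[OF _ mult_le_mono2[of 1]])
    also have "\<dots> \<le> N * p * length t"
      using f(3) by simp
    finally show ?thesis by simp
  qed
  \<comment> \<open>The exponent is \<open>Suc N\<close> because one factor \<open>f\<close> is
    absorbed into \<sigma> when the commutator with \<open>g\<close> is formed.\<close>
  define h where "h = f ^ Suc N"
  have h: "h \<noteq> 0" "lw h = word_pow (Suc N * p) t" "deg h = Suc N * ?m"
  proof -
    show "h \<noteq> 0" "lw h = word_pow (Suc N * p) t"
      unfolding h_def using lw_power(1,2)[OF f(1), of "Suc N"]
      by (simp_all only: f(2) word_pow_mult not_False_eq_True)
    then show "deg h = Suc N * ?m"
      by (simp add: deg_lw deg_f algebra_simps)
  qed
  have hg: "commutator h g \<noteq> 0" "lw (commutator h g) = word_pow (N * p) t @ \<sigma>"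
    unfolding h_def using lw_commutator_power by auto
  define I where "I = {l\<in>\<Lambda>. R l \<noteq> 0}"
  define x where "x l = ?E (R l) * commutator h g * b l" for l
  have x: "x l \<noteq> 0" "lw (x l) = lw (?E (R l)) @ (word_pow (N * p) t @ \<sigma>) @ l" if "l \<in> I" for l
  proof -
    have *: "?E (R l) \<noteq> 0" "b l \<noteq> 0" "lw (b l) = l"
      using that R(1) bl by (auto simp: I_def)
    show "x l \<noteq> 0" "lw (x l) = lw (?E (R l)) @ (word_pow (N * p) t @ \<sigma>) @ l"
      unfolding x_def using * hg lw_mult(1,2)[OF *(1) hg(1)] lw_mult(1,2)[OF _ *(2), of "?E (R l) * commutator h g"]
      by simp_all
  qed
  have expansion: "commutator h (?E P) = sum x I"
  proof -
    have "commutator h (?E P) = sum x \<Lambda>"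
      unfolding x_def R_def
    proof (rule commutator_cofactor_expansion)
      show "commutator h f = 0"
        by (simp only: commutator_def h_def power_commutes diff_self)
    qed (use \<open>finite \<Lambda>\<close> \<gamma>'2 SV in \<open>auto simp: \<Lambda>_def S_def \<gamma>_def\<close>)
    also have "\<dots> = sum x I"
      using \<open>finite \<Lambda>\<close> by (intro sum.mono_neutral_right) (auto simp: I_def x_def)
    finally show ?thesis .
  qed
  \<comment> \<open>Equal leading words of two terms are two factorizations around the same central
    word, with good right factors \<open>l\<close> and \<open>l'\<close>.\<close>
  have "inj_on (\<lambda>l. lw (x l)) I"
  proof (rule inj_onI)
    fix l l' assume l: "l \<in> I" "l' \<in> I" "lw (x l) = lw (x l')"
    show "l = l'"
      by (rule no_collision[of "lw (?E (R l))" "N * p" _ "lw (?E (R l'))"])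
        (use l x bl N in \<open>auto simp: I_def\<close>)
  qed
  have "finite I" using \<open>finite \<Lambda>\<close> by (simp add: I_def)
  note sum_x = lw_sum[OF \<open>finite I\<close> _ x(1) \<open>inj_on (\<lambda>l. lw (x l)) I\<close>, folded expansion]

  define w where "w = weighted_deg ?m ?n P"
  define T where "T = {W\<in>Poly_Mapping.keys P. ?wt W = w}"
  obtain W\<^sub>0 where W0: "W\<^sub>0 \<in> T"
    using weighted_deg_attained[OF Suc.prems(2)] by (auto simp: T_def w_def)
  have bound: "?E P \<noteq> 0 \<and> deg (commutator f g) * w \<le> (?m + ?n) * deg (?E P)"
  proof (cases "T = {W\<^sub>0}")
    \<comment> \<open>With a single word of top weight the degree is exactly \<open>w\<close>, and
      \<open>deg_commutator_le\<close> gives the factor.\<close>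
    case True
    have *: "?E P \<noteq> 0 \<and> deg (?E P) = ?wt W\<^sub>0"
    proof (rule degree_bound_if_unique_top_word)
      fix W assume W: "W \<in> Poly_Mapping.keys P" "W \<noteq> W\<^sub>0"
      then have "?wt W \<noteq> w" using True by (auto simp: T_def)
      then show "?wt W < ?wt W\<^sub>0"
        using weight_le_weighted_deg[OF W(1), of ?m ?n] W0 by (auto simp: T_def w_def)
    qed (use W0 in \<open>auto simp: T_def\<close>)
    moreover have "?wt W\<^sub>0 = w" using W0 by (simp add: T_def)
    ultimately show ?thesis
      using deg_commutator_le[OF f(1) g(1)] by simp
  next
    case False
    then obtain W\<^sub>1 where W1: "W\<^sub>1 \<in> T" "W\<^sub>1 \<noteq> W\<^sub>0" using W0 by blast
    \<comment> \<open>\<open>d W\<close> is the leading coefficient of the value of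
      \<open>W\<close>, multiplicative in \<open>W\<close>.\<close>
    define d where "d W = lc f ^ count_list W X * lc g ^ count_list W Y" for W
    have d: "d W \<noteq> 0" "d (W @ W') = d W * d W'" for W W'
      using lc_nonzero f(1) g(1) by (auto simp: d_def power_add)
    \<comment> \<open>The prefix \<open>A\<close> leaves suffixes of weight at least
      \<open>?m\<close> in the top words, and the leading coefficients of the top words beginning
      with \<open>A\<close> and \<open>Y\<close> do not cancel.\<close>
    have "\<exists>A. ?wt A + ?n + ?m \<le> w \<and>
      (\<Sum>W | W \<in> T \<and> (\<exists>U. W = A @ Y # U). Poly_Mapping.lookup P W * d W) \<noteq> 0"
    proof (rule nonzero_split_sum[OF _ _ _ W1(1) W0 W1(2) ndvd])
      show "Poly_Mapping.lookup P W * d W \<noteq> 0" if "W \<in> T" for W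
        using that d(1)[of W] by (simp add: T_def in_keys_iff)
    qed (simp_all add: T_def)
    then obtain A where A: "?wt A + ?n + ?m \<le> w"
      "(\<Sum>W | W \<in> T \<and> (\<exists>U. W = A @ Y # U). Poly_Mapping.lookup P W * d W) \<noteq> 0"
      by blast
    define j where "j = w - ?n - ?wt A"
    have j: "w = ?wt A + ?n + j" "?m \<le> j" using A(1) by (auto simp: j_def)
    obtain U\<^sub>0 where U0: "A @ Y # U\<^sub>0 \<in> T"
    proof (rule ccontr)
      assume "\<not> thesis"
      then have "{W. W \<in> T \<and> (\<exists>U. W = A @ Y # U)} = {}" using that by blast
      then show False using A(2) by (simp only: sum.empty simp_thms)
    qed
    define l where "l = lw (word_val f g U\<^sub>0)"
    have U0j: "?wt U\<^sub>0 = j" using U0 j(1) by (auto simp: T_def)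
    have lw_pow: "\<exists>k. lw (word_val f g U) = word_pow k t" for U
    proof -
      have "\<exists>k. xy_word (word_pow p t) (word_pow q t) U = word_pow k t"
      proof (induction U)
        case Nil
        then show ?case by (intro exI[of _ 0]) simp
      next
        case (Cons a U)
        then show ?case by (cases a) (auto simp flip: word_pow_add)
      qed
      then show ?thesis using lw_word_val(2)[OF f(1) g(1)] f(2) g(2) by simp
    qed
    have length_lw: "length (lw (word_val f g U)) = ?wt U" for U
      using lw_word_val[OF f(1) g(1), of U] deg_lw by metis
    \<comment> \<open>A power of \<open>t\<close> is determined by its length, so all suffixes of
      weight \<open>j\<close> share the leading word \<open>l\<close>.\<close>
    have same: "lw (word_val f g U) = l" if "?wt U = j" for U
      using lw_pow[of U] lw_pow[of U\<^sub>0] length_lw[of U] length_lw[of U\<^sub>0] that U0j t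
      by (auto simp: l_def primitive_word_def)
    have in_S: "U \<in> S" if "A @ Y # U \<in> Poly_Mapping.keys P" for U
      using that by (auto simp: S_def)
    \<comment> \<open>Up to the factor \<open>d (A @ [Y])\<close>, the coefficient of
      \<open>A\<close> in \<open>R l\<close> is the nonzero sum found above: a suffix
      \<open>U\<close> of weight \<open>j\<close> has coordinate \<open>d U\<close> at
      \<open>l\<close>, and lighter suffixes have coordinate 0 because their leading words lie below
      \<open>l\<close>.\<close>
    have "Poly_Mapping.lookup (R l) A * d (A @ [Y])
      = (\<Sum>W | W \<in> Poly_Mapping.keys P \<and> (\<exists>U. W = A @ Y # U). if W \<in> T then Poly_Mapping.lookup P W * d W else 0)"
      unfolding R_def lookup_cofactor sum_distrib_right
    proof (intro sum.cong refl)
      fix W assume "W \<in> {W. W \<in> Poly_Mapping.keys P \<and> (\<exists>U. W = A @ Y # U)}"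
      then obtain U where W: "W = A @ Y # U" "A @ Y # U \<in> Poly_Mapping.keys P" by auto
      have UV: "word_val f g U \<in> V" using SV in_S W by blast
      have wtU: "?wt W = ?wt A + ?n + ?wt U" using W(1) by simp
      have "Poly_Mapping.lookup (\<gamma> U) l = (if W \<in> T then d U else 0)"
      proof (cases "W \<in> T")
        case True
        then have "?wt U = j" using wtU j(1) by (simp add: T_def)
        then show ?thesis
          using same[of U] \<gamma>'4[OF UV lw_word_val(1)[OF f(1) g(1)]] lw_word_val(3)[OF f(1) g(1), of U] True
          by (simp add: \<gamma>_def d_def)
      next
        case False
        then have "?wt W < w"
          using W weight_le_weighted_deg[of W P ?m ?n] by (auto simp: T_def w_def)
        then have "?wt U < j" using wtU j(1) by simp
        then have "code (lw (word_val f g U)) < code l"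
          using length_lw[of U] length_lw[of U\<^sub>0] U0j by (intro code_less_if_length) (simp add: l_def)
        then have "l \<notin> Poly_Mapping.keys (\<gamma> U)"
          using \<gamma>'3[OF UV, of l] by (auto simp: \<gamma>_def)
        then show ?thesis using False by (simp add: in_keys_iff)
      qed
      moreover have "d W = d U * d (A @ [Y])"
        using d(2)[of "A @ [Y]" U] W(1) by simp
      ultimately show "Poly_Mapping.lookup P W * Poly_Mapping.lookup (\<gamma> (drop (Suc (length A)) W)) l * d (A @ [Y])
        = (if W \<in> T then Poly_Mapping.lookup P W * d W else 0)"
        using W(1) by simp
    qed
    also have "\<dots> = (\<Sum>W | W \<in> T \<and> (\<exists>U. W = A @ Y # U). Poly_Mapping.lookup P W * d W)"
    proof -
      have "finite {W. W \<in> Poly_Mapping.keys P \<and> (\<exists>U. W = A @ Y # U)}"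
        by (rule finite_subset[of _ "Poly_Mapping.keys P"]) auto
      then show ?thesis
        by (subst sum.inter_filter[symmetric]) (auto simp: T_def intro!: sum.cong)
    qed
    finally have "Poly_Mapping.lookup (R l) A \<noteq> 0" using A(2) by auto
    then have RA: "A \<in> Poly_Mapping.keys (R l)" "R l \<noteq> 0" by (auto simp: in_keys_iff)
    have "l \<in> \<Lambda>"
    proof -
      have "U\<^sub>0 \<in> S" using U0 in_S by (auto simp: T_def)
      moreover have "Poly_Mapping.lookup (\<gamma> U\<^sub>0) l \<noteq> 0"
        using \<gamma>'4[OF SV[OF \<open>U\<^sub>0 \<in> S\<close>]] lc_nonzero lw_word_val(1)[OF f(1) g(1), of U\<^sub>0]
        by (simp add: \<gamma>_def l_def)
      ultimately show ?thesis by (auto simp: \<Lambda>_def in_keys_iff)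
    qed
    then have "l \<in> I" using RA by (simp add: I_def)
    then have ne: "I \<noteq> {}" by auto
    have PN: "commutator h (?E P) \<noteq> 0" using sum_x(1)[OF ne] by simp
    then have EP: "?E P \<noteq> 0" by auto
    \<comment> \<open>The terms do not cancel, so \<open>x l\<close> alone bounds the degree of the
      commutator from below. That degree is at most \<open>deg h + deg (?E P)\<close>, and
      \<open>N * ?m\<close> drops out of the comparison, leaving one \<open>?m\<close>.\<close>
    have "code (lw (x l)) \<le> code (lw (commutator h (?E P)))"
      using sum_x(3)[OF ne _ \<open>l \<in> I\<close>] by simp
    then have "length (lw (x l)) \<le> length (lw (commutator h (?E P)))"
      by (rule code_le_length)
    also have "\<dots> \<le> length (lw h) + length (lw (?E P))"
      using deg_commutator_le[OF h(1) EP] by (simp add: deg_lw PN h(1) EP)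
    finally have "deg (?E (R l)) + N * ?m + deg (commutator f g) + j \<le> Suc N * ?m + deg (?E P)"
      using x(2)[OF \<open>l \<in> I\<close>] h(2,3) EP R(1)[OF RA(2)] comm length_lw[of U\<^sub>0] U0j
      by (simp add: deg_lw l_def deg_f algebra_simps)
    then have le: "deg (?E (R l)) + deg (commutator f g) + j \<le> ?m + deg (?E P)" by simp
    have "deg (commutator f g) * ?wt A \<le> deg (commutator f g) * weighted_deg ?m ?n (R l)"
      using weight_le_weighted_deg[OF RA(1)] by simp
    also have "\<dots> \<le> (?m + ?n) * deg (?E (R l))"
      by (rule R(3)[OF RA(2)])
    finally have wtA: "deg (commutator f g) * ?wt A \<le> (?m + ?n) * deg (?E (R l))" .
    define c where "c = deg (commutator f g)"
    have "c * w \<le> (?m + ?n) * deg (?E P)"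
    proof -
      obtain e where e: "j = ?m + e" using j(2) le_Suc_ex by blast
      \<comment> \<open>The weight \<open>w\<close> splits as \<open>?wt A\<close>,
        \<open>?m + ?n\<close> and \<open>e\<close>. The first part is paid for by the degree of the
        cofactor, the second by the commutator itself, the third by
        \<open>deg_commutator_le\<close>.\<close>
      have "c * w = c * ?wt A + c * (?m + ?n) + c * e"
        using j(1) e by (simp add: algebra_simps)
      also have "\<dots> \<le> (?m + ?n) * deg (?E (R l)) + c * (?m + ?n) + (?m + ?n) * e"
        using wtA deg_commutator_le[OF f(1) g(1)] by (intro add_mono) (auto simp: c_def)
      also have "\<dots> = (?m + ?n) * (deg (?E (R l)) + c + e)"
        by (simp add: algebra_simps)
      also have "\<dots> \<le> (?m + ?n) * deg (?E P)"
        using le e by (intro mult_le_mono2) (simp add: c_def)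
      finally show ?thesis .
    qed
    then show ?thesis using EP by (simp add: c_def)
  qed
  \<comment> \<open>If the leading word does not commute with \<open>t\<close>, then multiplied by a
    power of \<open>t\<close> on one side it is the leading word of some \<open>x l\<close>, a
    product of good words; the power of \<open>t\<close> can be cancelled.\<close>
  have "good (lw (?E P))"
  proof (cases "lw (?E P) @ t = t @ lw (?E P)")
    case True
    then show ?thesis by (rule good_if_commute)
  next
    case False
    have EP: "?E P \<noteq> 0" using bound by simp
    have "lw (?E P) @ lw h \<noteq> lw h @ lw (?E P)"
      using False commute_if_commute_word_pow[of "lw (?E P)" "Suc N * p" t] f(3) h(2) by auto
    then have *: "commutator h (?E P) \<noteq> 0 \<and> (lw (commutator h (?E P)) = lw h @ lw (?E P) \<or>
        lw (commutator h (?E P)) = lw (?E P) @ lw h)"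
      using lw_commutator[OF h(1) EP] code_inj by (meson linorder_neqE_nat)
    then have "I \<noteq> {}" using expansion by auto
    from sum_x(2)[OF this] obtain l where l: "l \<in> I" "lw (commutator h (?E P)) = lw (x l)"
      by auto
    have "good (lw (x l))"
      unfolding x(2)[OF l(1)] using R(2) bl(3) l(1) good_sigma
      by (intro good_append good_word_pow) (auto simp: I_def)
    then show ?thesis
      using * l(2) h(2) good_cancel_left good_cancel_right by metis
  qed
  with bound show ?case by (simp add: w_def)
qed

end

section \<open>Reversing words\<close>

text \<open>\<open>map_key\<close> pulls back along \<open>rev\<close>; as \<open>rev\<close> is an
  involution, this is the anti-automorphism reversing every word.\<close>

definition mirror :: "('a, 'k::field) free_algebra \<Rightarrow> ('a, 'k) free_algebra" where
  "mirror f = Poly_Mapping.map_key rev f"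

lemma lookup_mirror [simp]: "Poly_Mapping.lookup (mirror f) w = Poly_Mapping.lookup f (rev w)"
  by (simp add: mirror_def map_key.rep_eq)

lemma keys_mirror: "Poly_Mapping.keys (mirror f) = rev ` Poly_Mapping.keys f"
proof -
  have "x \<in> Poly_Mapping.keys (mirror f) \<longleftrightarrow> x \<in> rev ` Poly_Mapping.keys f" for x
    by (metis image_iff in_keys_iff lookup_mirror rev_rev_ident)
  then show ?thesis by blast
qed

lemma mirror_diff: "mirror (f - g) = mirror f - mirror g"
  by (rule poly_mapping_eqI) (simp add: lookup_minus)

lemma mirror_zero_iff [simp]: "mirror f = 0 \<longleftrightarrow> f = 0"
  by (metis keys_eq_empty keys_mirror image_is_empty)

lemma mirror_sum: "mirror (\<Sum>i\<in>I. f i) = (\<Sum>i\<in>I. mirror (f i))"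
  by (rule poly_mapping_eqI) (simp add: lookup_sum)

lemma mirror_single: "mirror (Poly_Mapping.single w c) = Poly_Mapping.single (rev w) c"
  by (rule poly_mapping_eqI) (auto simp: lookup_single when_def)

text \<open>By bilinearity it is enough to reverse products of monomials.\<close>

lemma mirror_mult: "mirror (f * g) = mirror g * mirror f"
proof -
  let ?s = "\<lambda>h k. Poly_Mapping.single k (Poly_Mapping.lookup h k)"
  let ?m = "\<lambda>h. \<Sum>k\<in>Poly_Mapping.keys h. mirror (?s h k)"
  have single: "mirror (Poly_Mapping.single k a * Poly_Mapping.single l c) =
      mirror (Poly_Mapping.single l c) * mirror (Poly_Mapping.single k a)" for k l :: "'a list" and a c :: 'b
    by (simp add: mult_single mirror_single plus_list_def mult.commute[of a c])
  have m: "mirror h = ?m h" for h :: "('a, 'b) free_algebra"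
    using arg_cong[OF poly_mapping_sum_singles[of h], of mirror] by (simp only: mirror_sum)
  have "f * g = (\<Sum>k\<in>Poly_Mapping.keys f. ?s f k) * (\<Sum>l\<in>Poly_Mapping.keys g. ?s g l)"
    using poly_mapping_sum_singles[of f] poly_mapping_sum_singles[of g] by (rule arg_cong2)
  then have "mirror (f * g) = (\<Sum>k\<in>Poly_Mapping.keys f. \<Sum>l\<in>Poly_Mapping.keys g. mirror (?s f k * ?s g l))"
    by (simp only: sum_product mirror_sum)
  also have "\<dots> = (\<Sum>k\<in>Poly_Mapping.keys f. \<Sum>l\<in>Poly_Mapping.keys g. mirror (?s g l) * mirror (?s f k))"
    by (simp only: single)
  also have "\<dots> = ?m g * ?m f"
    unfolding sum_product by (rule sum.swap)
  finally show ?thesis by (simp only: m[of f, symmetric] m[of g, symmetric])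
qed

lemma mirror_one [simp]: "mirror 1 = 1"
  unfolding single_one[symmetric] by (simp add: mirror_single zero_list_def)

lemma mirror_word_val: "mirror (word_val f g W) = word_val (mirror f) (mirror g) (rev W)"
  by (induction W) (auto simp: mirror_mult split: xy.split)

lemma mirror_subst_xy: "mirror (subst_xy f g P) = subst_xy (mirror f) (mirror g) (mirror P)"
proof -
  have "mirror P = (\<Sum>W\<in>Poly_Mapping.keys P. Poly_Mapping.single (rev W) (Poly_Mapping.lookup P W))"
    using arg_cong[OF poly_mapping_sum_singles[of P], of mirror] by (simp only: mirror_sum mirror_single)
  then have "subst_xy (mirror f) (mirror g) (mirror P) =
      (\<Sum>W\<in>Poly_Mapping.keys P. scalar (Poly_Mapping.lookup P W) * word_val (mirror f) (mirror g) (rev W))"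
    by (simp only: subst_xy_sum subst_xy_single)
  also have "\<dots> = mirror (subst_xy f g P)"
    unfolding subst_xy_def mirror_sum
    by (intro sum.cong refl) (simp add: mirror_mult mirror_word_val scalar_def mirror_single scalar_commute[unfolded scalar_def])
  finally show ?thesis by simp
qed

lemma mirror_commutator: "mirror (commutator f g) = - commutator (mirror f) (mirror g)"
  by (simp add: commutator_def mirror_diff mirror_mult)

lemma deg_mirror [simp]: "deg (mirror f) = deg f"
  by (simp add: deg_def keys_mirror image_image)

lemma deg_uminus [simp]: "deg (- f) = deg f"
  by (simp add: deg_def)

lemma weighted_deg_mirror [simp]: "weighted_deg a b (mirror P) = weighted_deg a b P"
  by (simp add: weighted_deg_def keys_mirror image_image weight_def)

context word_order
begin

lemma word_order_rev: "word_order (\<lambda>w. code (rev w))"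
  by unfold_locales (auto dest: code_inj code_append_left code_append_right code_length)

lemma lw_uminus: "lw (- f) = lw f"
  by (simp add: lw_def)

lemma lw_mirror:
  assumes "f \<noteq> 0"
  shows "word_order.lw (\<lambda>w. code (rev w)) (mirror f) = rev (lw f)"
proof -
  interpret M: word_order "\<lambda>w. code (rev w)" by (rule word_order_rev)
  have "M.leads (rev (lw f)) (lc f) (mirror f)"
    using leads_lw[OF assms] by (auto simp: leads_def M.leads_def keys_mirror)
  then show ?thesis
    using M.leads_imp_lw(2) lc_nonzero[OF assms] by blast
qed

end

section \<open>Words as numerals\<close>

fun numeral_of_word :: "('a \<Rightarrow> nat) \<Rightarrow> nat \<Rightarrow> 'a list \<Rightarrow> nat" where
  "numeral_of_word d K [] = 0"
| "numeral_of_word d K (x # w) = d x * K ^ length w + numeral_of_word d K w"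

lemma numeral_of_word_append:
  "numeral_of_word d K (u @ v) = numeral_of_word d K u * K ^ length v + numeral_of_word d K v"
  by (induction u) (simp_all add: algebra_simps power_add)

lemma numeral_of_word_bound:
  assumes "\<And>x. d x < K"
  shows "numeral_of_word d K w < K ^ length w"
proof (induction w)
  case (Cons x w)
  have "numeral_of_word d K (x # w) < Suc (d x) * K ^ length w"
    using Cons.IH by simp
  also have "\<dots> \<le> K * K ^ length w"
    using assms[of x] by (intro mult_le_mono1) simp
  finally show ?case by simp
qed simp

text \<open>The two numerals of a word add up to a number depending only on its length. For digits
  from 1 to \<open>K - 1\<close> the complement \<open>K - d x\<close> lies in the same
  range.\<close>

lemma numeral_of_word_complement:
  assumes "length u = length v" "\<And>x. d x < K"
    and "numeral_of_word d K u < numeral_of_word d K v"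
  shows "numeral_of_word (\<lambda>x. K - d x) K v < numeral_of_word (\<lambda>x. K - d x) K u"
proof -
  have "numeral_of_word d K u + numeral_of_word (\<lambda>x. K - d x) K u
      = numeral_of_word d K v + numeral_of_word (\<lambda>x. K - d x) K v"
    using assms(1)
  proof (induction u v rule: list_induct2)
    case (Cons x xs y ys)
    have *: "d z * n + (K - d z) * n = K * n" for z n
      using assms(2)[of z] by (metis add_mult_distrib le_add_diff_inverse less_imp_le)
    show ?case
      using Cons *[of x "K ^ length ys"] *[of y "K ^ length ys"] by simp
  qed simp
  then show ?thesis using assms(3) by linarith
qed

lemma numeral_of_word_inj:
  assumes "inj d" "\<And>x. d x < K" "length u = length v" "numeral_of_word d K u = numeral_of_word d K v"
  shows "u = v"
  using assms(3,4)
proof (induction u v rule: list_induct2)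
  case (Cons x xs y ys)
  define N where "N = K ^ length xs"
  have b: "numeral_of_word d K xs < N" "numeral_of_word d K ys < N"
    unfolding N_def using numeral_of_word_bound[of d K] assms(2) Cons.hyps by metis+
  have e: "d x * N + numeral_of_word d K xs = d y * N + numeral_of_word d K ys"
    using Cons.prems Cons.hyps by (simp add: N_def)
  have "d x = (d x * N + numeral_of_word d K xs) div N"
    using b(1) by simp
  also have "\<dots> = d y"
    unfolding e using b(2) by simp
  finally have "d x = d y" .
  then show ?case
    using Cons e assms(1) by (auto dest: injD)
qed simp

text \<open>A nonzero first digit outweighs every shorter numeral.\<close>

lemma numeral_of_word_less_if_length:
  assumes "\<And>x. 0 < d x" "\<And>x. d x < K" "length u < length v"
  shows "numeral_of_word d K u < numeral_of_word d K v"
proof -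
  obtain x w where v: "v = x # w" using assms(3) by (cases v) auto
  have "K > 0" using assms(2)[of x] by simp
  have "numeral_of_word d K u < K ^ length u"
    using numeral_of_word_bound assms(2) by metis
  also have "\<dots> \<le> K ^ length w"
    using assms(3) v \<open>K > 0\<close> by (intro power_increasing) auto
  also have "\<dots> \<le> numeral_of_word d K v"
    using assms(1)[of x] by (cases "d x") (simp_all add: v)
  finally show ?thesis .
qed

text \<open>With nonzero digits the numerical order is the degree-lexicographic order.\<close>

lemma word_order_numeral_of_word:
  fixes d :: "'a \<Rightarrow> nat"
  assumes "inj d" "\<And>x. 0 < d x" "\<And>x. d x < K"
  shows "word_order (numeral_of_word d K)"
proof
  note less = numeral_of_word_less_if_length[of d K, OF assms(2,3)]
  show len: "length u \<le> length v" if "numeral_of_word d K u < numeral_of_word d K v" for u v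
    using less[of v u] that by (meson not_le less_asym)
  show "u = v" if "numeral_of_word d K u = numeral_of_word d K v" for u v
    using less[of u v] less[of v u] that numeral_of_word_inj[OF assms(1,3), of u v]
    by (metis less_irrefl linorder_neqE_nat)
  fix u v w assume uv: "numeral_of_word d K u < numeral_of_word d K v"
  show "numeral_of_word d K (w @ u) < numeral_of_word d K (w @ v)"
  proof (cases "length u = length v")
    case True
    then show ?thesis using uv by (simp add: numeral_of_word_append)
  next
    case False
    then show ?thesis using len[OF uv] by (intro less) simp
  qed
  have "0 < K ^ length w"
  proof (cases w)
    case (Cons x w')
    then show ?thesis using assms(3)[of x] by simp
  qed simp
  then show "numeral_of_word d K (u @ w) < numeral_of_word d K (v @ w)"
    using uv by (simp only: numeral_of_word_append add_less_cancel_right mult_less_cancel2 simp_thms)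
qed

lemma finite_digits:
  obtains d :: "'a::finite \<Rightarrow> nat" and K where "inj d" "\<And>x. 0 < d x" "\<And>x. d x < K"
proof -
  obtain e :: "'a \<Rightarrow> nat" and n where e: "e ` UNIV = {i. i < n}" "inj e"
    using finite_imp_inj_to_nat_seg[OF finite_UNIV] by auto
  have "e x < n" for x using e(1) by blast
  then show ?thesis
    using that[of "\<lambda>x. Suc (e x)" "Suc n"] e(2) by (auto simp: inj_def)
qed

text \<open>Either the digits or their complements put \<open>u\<close> below \<open>v\<close>. So
  the direction in which \<open>L\<close> compares \<open>\<sigma> @ t\<close> with
  \<open>t @ \<sigma>\<close> can be prescribed.\<close>

lemma lexicographic_numeral:
  fixes u v :: "'a::finite list"
  assumes "length u = length v" "u \<noteq> v"
  obtains L :: "'a list \<Rightarrow> nat" and K where "\<And>u v. L (u @ v) = L u * K ^ length v + L v"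
    "\<And>v. L v < K ^ length v" "L u < L v"
proof -
  obtain d :: "'a \<Rightarrow> nat" and K where d: "inj d" "\<And>x. 0 < d x" "\<And>x. d x < K"
    using finite_digits by blast
  have d': "K - d x < K" for x using d(2,3)[of x] by simp
  have "numeral_of_word d K u \<noteq> numeral_of_word d K v"
    using numeral_of_word_inj[OF d(1,3) assms(1)] assms(2) by blast
  then consider "numeral_of_word d K u < numeral_of_word d K v"
    | "numeral_of_word d K v < numeral_of_word d K u"
    by linarith
  then show ?thesis
  proof cases
    case 1
    then show ?thesis
      by (intro that[of "numeral_of_word d K" K] numeral_of_word_append numeral_of_word_bound d(3))
  next
    case 2
    show ?thesis
      by (intro that[of "numeral_of_word (\<lambda>x. K - d x) K" K] numeral_of_word_append numeral_of_word_bound d'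
          numeral_of_word_complement[OF assms(1)[symmetric] d(3) 2])
  qed
qed

section \<open>The degree estimate\<close>

lemma degree_bound_commuting_good:
  fixes f g :: "('a::finite, 'k::field) free_algebra" and code :: "'a list \<Rightarrow> nat"
  assumes "word_order code" "primitive_word t"
    and f: "f \<noteq> 0" "word_order.lw code f = word_pow p t" "p > 0"
    and g: "g \<noteq> 0" "word_order.lw code g = word_pow q t" "q > 0"
    and comm: "commutator f g \<noteq> 0"
    and less: "code (word_order.lw code (commutator f g) @ t) < code (t @ word_order.lw code (commutator f g))"
    and ndvd: "\<not> deg f dvd deg g" "\<not> deg g dvd deg f" and P: "P \<noteq> 0"
  shows "deg (commutator f g) * weighted_deg (deg f) (deg g) P \<le> (deg f + deg g) * deg (subst_xy f g P)"
proof -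
  let ?\<sigma> = "word_order.lw code (commutator f g)"
  have "length (?\<sigma> @ t) = length (t @ ?\<sigma>)" "?\<sigma> @ t \<noteq> t @ ?\<sigma>"
    using less by auto
  then obtain L :: "'a list \<Rightarrow> nat" and K where L: "\<And>u v. L (u @ v) = L u * K ^ length v + L v"
    "\<And>v. L v < K ^ length v" "L (?\<sigma> @ t) < L (t @ ?\<sigma>)"
    using lexicographic_numeral by blast
  interpret word_order code by (fact assms(1))
  interpret commuting_leads code f g t p q L K
    by unfold_locales (fact assms L)+
  have "finite (Poly_Mapping.keys P)" by simp
  then obtain B where "\<forall>W\<in>Poly_Mapping.keys P. length W < B"
    using finite_nat_set_iff_bounded[of "length ` Poly_Mapping.keys P"] by auto
  then show ?thesis
    using degree_bound P by blast
qed

text \<open>By \<open>lw_commutator_not_word_pow\<close> and primitivity, \<sigma> does not commute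
  with \<open>t\<close>. Unlike \<open>L\<close>, the order \<open>code\<close> is tied to the
  leading words; if it compares the two products in the wrong direction, reversing all words
  exchanges them.\<close>

lemma degree_bound_commuting:
  fixes f g :: "('a::finite, 'k::field) free_algebra" and code :: "'a list \<Rightarrow> nat"
  assumes code: "word_order code"
    and fg: "f \<noteq> 0" "g \<noteq> 0" 
      "word_order.lw code f @ word_order.lw code g = word_order.lw code g @ word_order.lw code f"
    and comm: "commutator f g \<noteq> 0"
    and ndvd: "\<not> deg f dvd deg g" "\<not> deg g dvd deg f" and P: "P \<noteq> 0"
  shows "deg (commutator f g) * weighted_deg (deg f) (deg g) P \<le> (deg f + deg g) * deg (subst_xy f g P)"
proof -
  interpret word_order code by (fact code)
  interpret M: word_order "\<lambda>w. code (rev w)" by (rule word_order_rev)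
  have pos: "deg f \<noteq> 0" "deg g \<noteq> 0" using ndvd by (metis dvd_0_right)+
  then have ne: "lw f \<noteq> []" "lw g \<noteq> []" using fg by (auto simp: deg_lw)
  obtain t p q where t: "primitive_word t" "lw f = word_pow p t" "lw g = word_pow q t"
    using commuting_words_primitive_root[OF fg(3) ne(1)] by metis
  have pq: "p > 0" "q > 0" using ne t by (auto intro: Nat.gr0I)
  let ?\<sigma> = "lw (commutator f g)"
  have "?\<sigma> @ t \<noteq> t @ ?\<sigma>"
    using lw_commutator_not_word_pow[OF t(1) fg(1) t(2) pq(1) fg(2) t(3) pq(2) comm] primitive_wordD[OF t(1)]
    by metis
  then consider "code (?\<sigma> @ t) < code (t @ ?\<sigma>)" | "code (t @ ?\<sigma>) < code (?\<sigma> @ t)"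
    using code_inj by (meson linorder_neqE_nat)
  then show ?thesis
  proof cases
    case 1
    show ?thesis
      by (rule degree_bound_commuting_good[OF code t(1) fg(1) t(2) pq(1) fg(2) t(3) pq(2) comm 1 ndvd P])
  next
    case 2
    \<comment> \<open>The sign changes neither the leading word nor the degree.\<close>
    have comm_eq: "commutator (mirror f) (mirror g) = - mirror (commutator f g)"
      by (simp add: mirror_commutator)
    then have comm': "commutator (mirror f) (mirror g) \<noteq> 0"
      using comm by simp
    have \<sigma>': "M.lw (commutator (mirror f) (mirror g)) = rev ?\<sigma>"
      unfolding comm_eq by (simp add: M.lw_uminus lw_mirror comm)
    have "deg (commutator (mirror f) (mirror g)) * weighted_deg (deg (mirror f)) (deg (mirror g)) (mirror P)
        \<le> (deg (mirror f) + deg (mirror g)) * deg (subst_xy (mirror f) (mirror g) (mirror P))"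
    proof (rule degree_bound_commuting_good[OF word_order_rev primitive_word_rev[OF t(1)]])
      show "M.lw (mirror f) = word_pow p (rev t)" "M.lw (mirror g) = word_pow q (rev t)"
        using t fg by (simp_all add: lw_mirror rev_word_pow)
      show "code (rev (M.lw (commutator (mirror f) (mirror g)) @ rev t))
          < code (rev (rev t @ M.lw (commutator (mirror f) (mirror g))))"
        using 2 by (simp add: \<sigma>')
    qed (use fg pq comm' ndvd P in simp_all)
    then show ?thesis
      by (simp add: comm_eq flip: mirror_subst_xy)
  qed
qed

text \<open>By \<open>inj_xy_word\<close> the values of different words of \<open>P\<close> have
  different leading words, so nothing cancels.\<close>

lemma degree_bound_noncommuting:
  fixes f g :: "('a, 'k::field) free_algebra"
  assumes "word_order code" "f \<noteq> 0" "g \<noteq> 0"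
    and "word_order.lw code f @ word_order.lw code g \<noteq> word_order.lw code g @ word_order.lw code f"
    and "P \<noteq> 0"
  shows "weighted_deg (deg f) (deg g) P \<le> deg (subst_xy f g P)"
proof -
  interpret word_order code by (fact assms(1))
  let ?x = "\<lambda>W. scalar (Poly_Mapping.lookup P W) * word_val f g W"
  have x: "?x W \<noteq> 0" "lw (?x W) = xy_word (lw f) (lw g) W" if "W \<in> Poly_Mapping.keys P" for W
  proof -
    note l = leads_scalar[OF leads_lw[OF lw_word_val(1)[OF assms(2,3), of W]], where d = "Poly_Mapping.lookup P W"]
    have "Poly_Mapping.lookup P W * lc (word_val f g W) \<noteq> 0"
      using that lc_nonzero[OF lw_word_val(1)[OF assms(2,3)]] by (auto simp: in_keys_iff)
    note * = leads_imp_lw[OF l this]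
    show "?x W \<noteq> 0" "lw (?x W) = xy_word (lw f) (lw g) W"
      using * lw_word_val(2)[OF assms(2,3)] by auto
  qed
  have "inj_on (\<lambda>W. lw (?x W)) (Poly_Mapping.keys P)"
    using x(2) inj_xy_word[OF assms(4)] by (auto simp: inj_on_def inj_def)
  note s = lw_sum[OF finite_keys _ x(1) this, folded subst_xy_def]
  have ne: "Poly_Mapping.keys P \<noteq> {}" using assms(5) by simp
  obtain W where W: "W \<in> Poly_Mapping.keys P" "weight (deg f) (deg g) W = weighted_deg (deg f) (deg g) P"
    using weighted_deg_attained[OF assms(5)] by blast
  have "length (lw (?x W)) \<le> length (lw (subst_xy f g P))"
    using s(3)[OF ne _ W(1)] by (simp add: code_le_length)
  then show ?thesis
    using s(1)[OF ne] x(2)[OF W(1)] W(2) assms(2,3) by (simp add: deg_lw length_xy_word)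
qed

text \<open>The commutator of the two letters is a nonzero polynomial, and substitution is
  injective.\<close>

lemma commutator_nonzero_if_alg_independent:
  assumes "alg_independent f g"
  shows "commutator f g \<noteq> 0"
proof
  assume "commutator f g = 0"
  let ?c = "commutator (Poly_Mapping.single [X] 1) (Poly_Mapping.single [Y] 1) :: (xy, 'b) free_algebra"
  have "subst_xy f g ?c = subst_xy f g 0"
    using \<open>commutator f g = 0\<close> by (simp add: subst_xy_commutator)
  then have "?c = 0"
    using assms unfolding alg_independent_def bij_betw_def by (metis injD)
  moreover have "Poly_Mapping.lookup ?c [X, Y] = 1"
    by (simp add: commutator_def mult_single plus_list_def lookup_minus lookup_single)
  ultimately show False by simp
qed

theorem theorem1p1:
  fixes f g :: "('n::finite, 'k::field) free_algebra"
    and lt :: "'n free_group \<Rightarrow> 'n free_group \<Rightarrow> bool"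
    and P :: "(xy, 'k) free_algebra"
  assumes "card (UNIV :: 'n set) \<ge> 2"
    and "degree_group_order lt"
    and "alg_independent f g"
    and "alg_dependent (leading_monomial lt f) (leading_monomial lt g)"
    and "\<not> deg f dvd deg g"
    and "\<not> deg g dvd deg f"
    and "P \<notin> range scalar"
  shows "real (deg (subst_xy f g P)) \<ge>
    real (weighted_deg (deg f) (deg g) P) * (real (deg (commutator f g)) / real (deg f + deg g))"
proof -
  obtain d :: "'n \<Rightarrow> nat" and K where "inj d" "\<And>x. 0 < d x" "\<And>x. d x < K"
    using finite_digits by blast
  then interpret word_order "numeral_of_word d K"
    by (rule word_order_numeral_of_word)
  \<comment> \<open>Every number divides 0, so both degrees are positive; as
    \<open>deg 0 = 0\<close>, neither element is zero.\<close>
  have pos: "deg f \<noteq> 0" "deg g \<noteq> 0" using assms(5,6) by (metis dvd_0_right)+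
  then have fg: "f \<noteq> 0" "g \<noteq> 0" by (auto simp: deg_def)
  have "P \<noteq> 0" using assms(7) by (metis rangeI scalar_simps(3))
  have "deg (commutator f g) * weighted_deg (deg f) (deg g) P \<le> (deg f + deg g) * deg (subst_xy f g P)"
  proof (cases "lw f @ lw g = lw g @ lw f")
    case True
    show ?thesis
      by (rule degree_bound_commuting[OF word_order_axioms fg True
            commutator_nonzero_if_alg_independent[OF assms(3)] assms(5,6) \<open>P \<noteq> 0\<close>])
  next
    case False
    \<comment> \<open>Here the bound holds even without the factor, which is at most 1.\<close>
    show ?thesis
      by (intro mult_le_mono deg_commutator_le[OF fg]
          degree_bound_noncommuting[OF word_order_axioms fg False \<open>P \<noteq> 0\<close>])
  qed
  then have "real (deg (commutator f g)) * real (weighted_deg (deg f) (deg g) P)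
      \<le> real (deg f + deg g) * real (deg (subst_xy f g P))"
    by (metis of_nat_le_iff of_nat_mult)
  moreover have "real (deg f + deg g) > 0" using pos by simp
  ultimately show ?thesis
    by (simp add: divide_le_eq mult.commute)
qed

end
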